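(* Let $\Omega\subset\mathbb{R}^d$ be a bounded $C^{2,1}$ uniformly convex domain (with defining function $\xi$), $T>0$, and let $E\in C^{0,1}([0,T]\times\overline\Omega)^d$ be such that, for some constant $c_0>0$, $E(t,x)\cdot\nabla\xi(x)\ge c_0$ for all $t\in[0,T]$ and $x\in\partial\Omega$. Define $$\alpha(s,x,v)=\tfrac12\,(v\cdot\nabla\xi(x))^2+\big(v\cdot\nabla^2\xi(x)\cdot v+E(s,x)\cdot\nabla\xi(x)\big)\,|\xi(x)|.$$ Then there exists $\delta>0$ such that $\alpha$ is a $\delta$-kinetic distance and such that for all $(t,x,v)\in[0,T]\times\partial\Omega_\delta\times\mathbb{R}^d$ and $s\in[0,T]$, $$C_s^-\,\alpha(t,x,v)\le\alpha\big(s,X(s;t,x,v),V(s;t,x,v)\big)\le C_s^+\,\alpha(t,x,v),$$ with $$C_s^\pm=\exp\Big(\pm C_0\big[(|v|+1)|s-t|+\|E\|_{L^\infty}(s-t)^2\big]\Big),$$ where $C_0=C_0(\|\xi\|_{C^{2,1}},\|E\|_{C^{0,1}})$.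
   Context: Domain: $\Omega=\{\xi<0\}$, $\partial\Omega=\{\xi=0\}$ for a $C^{2,1}$ function $\xi:\mathbb{R}^d\to\mathbb{R}$ with $\nabla\xi\ne0$ near $\partial\Omega$, $n=\nabla\xi/|\nabla\xi|$ on $\partial\Omega$; uniformly convex means there is $C_\Omega>0$ with $v\cdot\nabla^2\xi(x)\cdot v\ge C_\Omega|v|^2$ for all $(x,v)\in\overline\Omega\times\mathbb{R}^d$. Grazing set: $\gamma_0=\{(x,v):x\in\partial\Omega,\ v\cdot n(x)=0\}$. For $\delta>0$, $\partial\Omega_\delta=\{x\in\overline\Omega:\operatorname{dist}(x,\partial\Omega)<\delta\}$. A function $\alpha:[0,T]\times\overline\Omega\times\mathbb{R}^d\to\mathbb{R}_+$ is a $\delta$-kinetic distance if it is continuous and, for all $(t,x,v)\in[0,T]\times\partial\Omega_\delta\times\mathbb{R}^d$, $\alpha(t,x,v)=0$ if and only if $(x,v)\in\gamma_0$. Flow: $(X_s,V_s)=(X(s;t,x,v),V(s;t,x,v))$ denotes the characteristic trajectory in $\overline\Omega\times\mathbb{R}^d$ given by $\partial_sX_s=V_s$, $\partial_sV_s=E(s,X_s)$, $X(t;t,x,v)=x$, $V(t;t,x,v)=v$, with specular reflection $V_{s^+}=V_{s^-}-2(n(X_s)\cdot V_{s^-})n(X_s)$ at every $s$ with $X_s\in\partial\Omega$.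
   Formalization: The lower bound is stated only for s with X_s in the collar ∂Ω_δ, α≥0 is claimed only on that collar, and C_0 may also depend on C_Ω and c_0; as printed these fail, e.g. α=0 at the minimiser of ξ with v=0, which a trajectory from the collar can reach. *)

theory Defs
  imports "HOL-Analysis.Analysis"
begin

definition grad :: "('a::euclidean_space \<Rightarrow> real) \<Rightarrow> 'a \<Rightarrow> 'a" where
  "grad f x = (THE D. GDERIV f x :> D)"

text \<open>As a bounded linear map, so that its metric is that of the operator norm;
  \<open>v \<bullet> blinfun_apply (hess f x) v\<close> is the quadratic form of the Hessian at \<open>x\<close>.\<close>

definition hess :: "('a::euclidean_space \<Rightarrow> real) \<Rightarrow> 'a \<Rightarrow> 'a \<Rightarrow>\<^sub>L 'a" where
  "hess f x = Blinfun (frechet_derivative (grad f) (at x))"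

text \<open>On the unbounded space the Lipschitz condition on the second derivatives is local, so that
  for instance \<open>\<lambda>x. (norm x)\<^sup>4 + (norm x)\<^sup>2 - 1\<close> is admitted.\<close>

definition C21 :: "('a::euclidean_space \<Rightarrow> real) \<Rightarrow> bool" where
  "C21 f \<longleftrightarrow> (\<forall>x. f differentiable (at x)) \<and> (\<forall>x. grad f differentiable (at x)) \<and>
     (\<forall>K. compact K \<longrightarrow> (\<exists>L. L-lipschitz_on K (hess f)))"

definition sup_norm :: "'a set \<Rightarrow> ('a \<Rightarrow> 'b::real_normed_vector) \<Rightarrow> real" where
  "sup_norm S f = (SUP x\<in>S. norm (f x))"

definition lip_seminorm :: "'a::metric_space set \<Rightarrow> ('a \<Rightarrow> 'b::metric_space) \<Rightarrow> real" where
  "lip_seminorm S f = Inf {L. L-lipschitz_on S f}"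

definition C01_norm :: "'a::metric_space set \<Rightarrow> ('a \<Rightarrow> 'b::real_normed_vector) \<Rightarrow> real" where
  "C01_norm S f = sup_norm S f + lip_seminorm S f"

definition C21_norm :: "'a::euclidean_space set \<Rightarrow> ('a \<Rightarrow> real) \<Rightarrow> real" where
  "C21_norm S f = sup_norm S f + sup_norm S (grad f) + sup_norm S (hess f) + lip_seminorm S (hess f)"

definition Omega :: "('a \<Rightarrow> real) \<Rightarrow> 'a set" where
  "Omega \<xi> = {x. \<xi> x < 0}"

definition uniformly_convex_domain :: "real \<Rightarrow> ('a::euclidean_space \<Rightarrow> real) \<Rightarrow> bool" where
  "uniformly_convex_domain C\<^sub>\<Omega> \<xi> \<longleftrightarrow>
     C21 \<xi> \<and> Omega \<xi> \<noteq> {} \<and> connected (Omega \<xi>) \<and> bounded (Omega \<xi>) \<and>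
     frontier (Omega \<xi>) = {x. \<xi> x = 0} \<and>
     (\<exists>U. open U \<and> frontier (Omega \<xi>) \<subseteq> U \<and> (\<forall>x\<in>U. grad \<xi> x \<noteq> 0)) \<and>
     (\<forall>x\<in>closure (Omega \<xi>). \<forall>v. v \<bullet> blinfun_apply (hess \<xi> x) v \<ge> C\<^sub>\<Omega> * (norm v)\<^sup>2)"

definition normal :: "('a::euclidean_space \<Rightarrow> real) \<Rightarrow> 'a \<Rightarrow> 'a" where
  "normal \<xi> x = grad \<xi> x /\<^sub>R norm (grad \<xi> x)"

definition grazing_set :: "('a::euclidean_space \<Rightarrow> real) \<Rightarrow> ('a \<times> 'a) set" where
  "grazing_set \<xi> = {(x, v). x \<in> frontier (Omega \<xi>) \<and> v \<bullet> normal \<xi> x = 0}"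

definition collar :: "('a::euclidean_space \<Rightarrow> real) \<Rightarrow> real \<Rightarrow> 'a set" where
  "collar \<xi> \<delta> = {x \<in> closure (Omega \<xi>). infdist x (frontier (Omega \<xi>)) < \<delta>}"

text \<open>The sign condition \<open>\<alpha> \<ge> 0\<close> is imposed on the collar, where the vanishing condition lives, and
  not on the whole phase space: a function such as \<open>alpha\<close> below is continuous everywhere but takes
  negative values deep inside the domain at points where \<open>E s x \<bullet> grad \<xi> x < 0\<close>.\<close>

definition kinetic_distance ::
  "('a::euclidean_space \<Rightarrow> real) \<Rightarrow> real \<Rightarrow> real \<Rightarrow> (real \<Rightarrow> 'a \<Rightarrow> 'a \<Rightarrow> real) \<Rightarrow> bool" where
  "kinetic_distance \<xi> T \<delta> \<alpha> \<longleftrightarrow>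
     continuous_on ({0..T} \<times> closure (Omega \<xi>) \<times> UNIV) (\<lambda>(t, x, v). \<alpha> t x v) \<and>
     (\<forall>t\<in>{0..T}. \<forall>x\<in>collar \<xi> \<delta>. \<forall>v.
        \<alpha> t x v \<ge> 0 \<and> (\<alpha> t x v = 0 \<longleftrightarrow> (x, v) \<in> grazing_set \<xi>))"

definition alpha ::
  "('a::euclidean_space \<Rightarrow> real) \<Rightarrow> (real \<Rightarrow> 'a \<Rightarrow> 'a) \<Rightarrow> real \<Rightarrow> 'a \<Rightarrow> 'a \<Rightarrow> real" where
  "alpha \<xi> E s x v = 1/2 * (v \<bullet> grad \<xi> x)\<^sup>2 +
     (v \<bullet> blinfun_apply (hess \<xi> x) v + E s x \<bullet> grad \<xi> x) * \<bar>\<xi> x\<bar>"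

text \<open>\<open>characteristic \<xi> T E t x v X V\<close>: the curve \<open>(X, V)\<close> on \<open>[0, T]\<close> is the trajectory
  \<open>s \<mapsto> (X(s;t,x,v), V(s;t,x,v))\<close> with specular reflection. At a time \<open>s\<close> with \<open>X s\<close> on the boundary,
  \<open>w\<close> and \<open>w'\<close> are the one-sided limits of \<open>V\<close> before and after \<open>s\<close>; the equations of motion hold
  from either side for \<open>V\<close> redefined at \<open>s\<close> by the corresponding limit, and \<open>V s\<close> itself may be either
  of the two, so that initial velocities of both orientations are allowed at boundary points.
  At \<open>s = 0\<close> (\<open>s = T\<close>) the condition on the left (right) is void. A trajectory through the
  grazing set does not exist if \<open>E\<close> points strictly outwards at the boundary of a convex domain.\<close>

definition characteristic ::
  "('a::euclidean_space \<Rightarrow> real) \<Rightarrow> real \<Rightarrow> (real \<Rightarrow> 'a \<Rightarrow> 'a) \<Rightarrow> real \<Rightarrow> 'a \<Rightarrow> 'a \<Rightarrow>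
     (real \<Rightarrow> 'a) \<Rightarrow> (real \<Rightarrow> 'a) \<Rightarrow> bool" where
  "characteristic \<xi> T E t x v X V \<longleftrightarrow>
     X t = x \<and> V t = v \<and>
     (\<forall>s\<in>{0..T}. X s \<in> closure (Omega \<xi>)) \<and>
     (\<forall>s\<in>{0..T}. X s \<in> Omega \<xi> \<longrightarrow>
        (X has_vector_derivative V s) (at s within {0..T}) \<and>
        (V has_vector_derivative E s (X s)) (at s within {0..T})) \<and>
     (\<forall>s\<in>{0..T}. X s \<in> frontier (Omega \<xi>) \<longrightarrow>
        (\<exists>w w'. V s \<in> {w, w'} \<and>
           w' = w - (2 * (normal \<xi> (X s) \<bullet> w)) *\<^sub>R normal \<xi> (X s) \<and>
           (X has_vector_derivative w) (at s within {0..s}) \<and>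
           (V(s := w) has_vector_derivative E s (X s)) (at s within {0..s}) \<and>
           (X has_vector_derivative w') (at s within {s..T}) \<and>
           (V(s := w') has_vector_derivative E s (X s)) (at s within {s..T})))"

end

theory Submission
  imports Defs
begin

text \<open>Where \<open>\<bar>\<xi>\<bar>\<close> is small, convexity and the outward field make \<open>\<alpha>\<close> at least a constant times
  \<open>(1 + \<bar>v\<bar>\<^sup>2) \<bar>\<xi>\<bar>\<close>. Along a trajectory the two leading terms of \<open>d\<alpha>/ds\<close> cancel and the rest
  is \<open>O((1 + \<bar>v\<bar>)\<^sup>3 \<bar>\<xi>\<bar>)\<close>, so \<open>\<bar>d\<alpha>/ds\<bar> \<le> C (1 + \<bar>v\<bar>) \<alpha>\<close>. Adding
  \<open>M\<^sub>1 max 0 (\<bar>\<xi>\<bar> - \<eta>)\<close> makes this inequality hold in the whole domain without changing \<open>\<alpha>\<close> near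
  the boundary. The second derivatives of \<open>\<xi>\<close> and the field are only Lipschitz, and \<open>V\<close> jumps at the
  boundary, so derivatives are replaced by bounds on difference quotients at each time, taken from
  either side; since \<open>\<alpha>\<close> and \<open>\<bar>V\<bar>\<close> are invariant under reflection, no analysis of the
  bounce times is needed. Gronwall with \<open>\<bar>V s\<bar> \<le> \<bar>v\<bar> + \<parallel>E\<parallel> \<bar>s - t\<bar>\<close> concludes.\<close>

section \<open>Calculus of local difference-quotient bounds\<close>

text \<open>A bound on the limsup of the difference quotients at \<open>x\<close>. Quantifying over
  all \<open>k\<close> above \<open>c\<close> keeps the sum, product and chain rules free of error
  terms; \<open>S\<close> allows one-sided versions, and metric values cover operators and
  pairs.\<close>

definition slope_le :: "(real \<Rightarrow> 'b::metric_space) \<Rightarrow> real \<Rightarrow> real set \<Rightarrow> real \<Rightarrow> bool" where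
  "slope_le f x S c \<longleftrightarrow> (\<forall>k>c. \<forall>\<^sub>F y in at x within S. dist (f y) (f x) \<le> k * \<bar>y - x\<bar>)"

lemma slope_le_mono: "slope_le f x S c \<Longrightarrow> c \<le> d \<Longrightarrow> slope_le f x S d"
  unfolding slope_le_def by (meson le_less_trans)

lemma slope_le_subset: "slope_le f x S c \<Longrightarrow> S' \<subseteq> S \<Longrightarrow> slope_le f x S' c"
  unfolding slope_le_def by (blast intro: filter_leD[OF at_le])

text \<open>Joins the left and right bounds at a bounce time.\<close>

lemma slope_le_Un:
  assumes "slope_le f x S c" "slope_le f x S' c"
  shows "slope_le f x (S \<union> S') c"
  using assms unfolding slope_le_def at_within_union eventually_sup by blast

lemma slope_le_transform:
  assumes "slope_le f x S c" "\<forall>\<^sub>F y in at x within S. dist (g y) (g x) \<le> dist (f y) (f x)"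
  shows "slope_le g x S c"
  unfolding slope_le_def
proof (intro allI impI)
  fix k assume "k > c"
  with assms(1) have "\<forall>\<^sub>F y in at x within S. dist (f y) (f x) \<le> k * \<bar>y - x\<bar>"
    by (simp add: slope_le_def)
  with assms(2) show "\<forall>\<^sub>F y in at x within S. dist (g y) (g x) \<le> k * \<bar>y - x\<bar>"
    by eventually_elim auto
qed

lemma slope_le_const: "0 \<le> c \<Longrightarrow> slope_le (\<lambda>_. a) x S c"
  unfolding slope_le_def by (auto intro!: always_eventually mult_nonneg_nonneg)

lemma slope_le_add:
  fixes f g :: "real \<Rightarrow> 'b::real_normed_vector"
  assumes "slope_le f x S c" "slope_le g x S d"
  shows "slope_le (\<lambda>y. f y + g y) x S (c + d)"
  unfolding slope_le_def
proof (intro allI impI)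
  fix k assume "k > c + d"
  define e where "e = (k - c - d) / 2"
  have "e > 0" using \<open>k > c + d\<close> by (simp add: e_def)
  have "\<forall>\<^sub>F y in at x within S. dist (f y) (f x) \<le> (c + e) * \<bar>y - x\<bar>"
    and "\<forall>\<^sub>F y in at x within S. dist (g y) (g x) \<le> (d + e) * \<bar>y - x\<bar>"
    using assms \<open>e > 0\<close> by (auto simp: slope_le_def)
  then show "\<forall>\<^sub>F y in at x within S. dist (f y + g y) (f x + g x) \<le> k * \<bar>y - x\<bar>"
  proof eventually_elim
    case (elim y)
    have "dist (f y + g y) (f x + g x) \<le> (c + e) * \<bar>y - x\<bar> + (d + e) * \<bar>y - x\<bar>"
      using dist_triangle_add[of "f y" "g y" "f x" "g x"] elim by linarith
    also have "\<dots> = k * \<bar>y - x\<bar>" by (simp add: e_def field_simps)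
    finally show ?case .
  qed
qed

lemma slope_le_tendsto:
  assumes "slope_le f x S c"
  shows "(f \<longlongrightarrow> f x) (at x within S)"
proof -
  have ev: "\<forall>\<^sub>F y in at x within S. dist (f y) (f x) \<le> (c + 1) * \<bar>y - x\<bar>"
    using assms by (simp add: slope_le_def)
  have "((\<lambda>y. (c + 1) * \<bar>y - x\<bar>) \<longlongrightarrow> (c + 1) * \<bar>x - x\<bar>) (at x within S)"
    by (intro tendsto_intros)
  then have lim: "((\<lambda>y. (c + 1) * \<bar>y - x\<bar>) \<longlongrightarrow> 0) (at x within S)" by simp
  have "((\<lambda>y. dist (f y) (f x)) \<longlongrightarrow> 0) (at x within S)"
    by (rule Lim_null_comparison[OF _ lim]) (use ev in simp)
  then show ?thesis by (subst tendsto_dist_iff)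
qed

text \<open>Leibniz rule for inner product, operator application and multiplication, all of which
  satisfy \<open>contr\<close>. Where one factor vanishes at \<open>x\<close>, the slope of the
  other drops out.\<close>

lemma slope_le_prod:
  assumes "bounded_bilinear prd"
    and contr: "\<And>a b. norm (prd a b) \<le> norm a * norm b"
    and f: "slope_le f x S c" and g: "slope_le g x S d"
  shows "slope_le (\<lambda>y. prd (f y) (g y)) x S (norm (f x) * d + c * norm (g x))"
  unfolding slope_le_def
proof (intro allI impI)
  interpret bounded_bilinear prd by fact
  fix k assume k: "k > norm (f x) * d + c * norm (g x)"
  \<comment> \<open>As \<open>e\<close> tends to 0 the perturbed bound tends to the claimed one, so
    some positive \<open>e\<close> keeps it below \<open>k\<close>.\<close>
  have "((\<lambda>e. norm (f x) * (d + e) + (c + e) * (norm (g x) + e)) \<longlongrightarrow>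
      norm (f x) * (d + 0) + (c + 0) * (norm (g x) + 0)) (at_right 0)"
    by (intro tendsto_intros)
  from order_tendstoD(2)[OF this, of k] k
  have "\<forall>\<^sub>F e in at_right 0. norm (f x) * (d + e) + (c + e) * (norm (g x) + e) < k" by simp
  then obtain e where e: "e > 0" "norm (f x) * (d + e) + (c + e) * (norm (g x) + e) < k"
    using eventually_happens'[OF trivial_limit_at_right_real
        eventually_conj[OF eventually_at_right_less[of "0::real"]]] by blast
  have "((\<lambda>y. norm (g y)) \<longlongrightarrow> norm (g x)) (at x within S)"
    using slope_le_tendsto[OF g] by (rule tendsto_norm)
  then have "\<forall>\<^sub>F y in at x within S. norm (g y) < norm (g x) + e"
    using e(1) by (intro order_tendstoD(2)) auto
  moreover have "\<forall>\<^sub>F y in at x within S. dist (f y) (f x) \<le> (c + e) * \<bar>y - x\<bar>"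
    and "\<forall>\<^sub>F y in at x within S. dist (g y) (g x) \<le> (d + e) * \<bar>y - x\<bar>"
    using f g e(1) by (auto simp: slope_le_def)
  ultimately show "\<forall>\<^sub>F y in at x within S. dist (prd (f y) (g y)) (prd (f x) (g x)) \<le> k * \<bar>y - x\<bar>"
  proof eventually_elim
    case (elim y)
    have "prd (f y) (g y) - prd (f x) (g x) = prd (f x) (g y - g x) + prd (f y - f x) (g y)"
      by (simp add: diff_left diff_right)
    then have "dist (prd (f y) (g y)) (prd (f x) (g x))
        \<le> norm (f x) * dist (g y) (g x) + dist (f y) (f x) * norm (g y)"
      by (metis add_mono contr dist_norm norm_triangle_le)
    also have "\<dots> \<le> norm (f x) * ((d + e) * \<bar>y - x\<bar>) + ((c + e) * \<bar>y - x\<bar>) * (norm (g x) + e)"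
      using elim e(1) by (intro add_mono mult_mono) (auto intro: order_trans[OF zero_le_dist])
    also have "\<dots> = (norm (f x) * (d + e) + (c + e) * (norm (g x) + e)) * \<bar>y - x\<bar>"
      by (simp add: algebra_simps)
    also have "\<dots> \<le> k * \<bar>y - x\<bar>"
      using e(2) by (intro mult_right_mono) auto
    finally show ?case .
  qed
qed

lemma slope_le_has_vector_derivative:
  assumes "(f has_vector_derivative D) (at x within S)"
  shows "slope_le f x S (norm D)"
  unfolding slope_le_def
proof (intro allI impI)
  fix k assume k: "k > norm D"
  then have "\<forall>\<^sub>F y in at x within S. norm (f y - f x - (y - x) *\<^sub>R D) \<le> (k - norm D) * norm (y - x)"
    using assms unfolding has_vector_derivative_def has_derivative_within_alt2 by simp
  then show "\<forall>\<^sub>F y in at x within S. dist (f y) (f x) \<le> k * \<bar>y - x\<bar>"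
  proof eventually_elim
    case (elim y)
    then have "norm (f y - f x) \<le> (k - norm D) * \<bar>y - x\<bar> + \<bar>y - x\<bar> * norm D"
      using norm_triangle_sub[of "f y - f x" "(y - x) *\<^sub>R D"] by simp
    then show ?case by (simp add: dist_norm algebra_simps)
  qed
qed

lemma slope_le_lipschitz_on:
  assumes "L-lipschitz_on D g" "slope_le u x S c" "\<And>y. y \<in> S \<Longrightarrow> u y \<in> D" "x \<in> S"
  shows "slope_le (\<lambda>y. g (u y)) x S (L * c)"
  unfolding slope_le_def
proof (intro allI impI)
  fix k assume k: "k > L * c"
  have "L \<ge> 0" using assms(1) by (rule lipschitz_on_nonneg)
  obtain e where e: "e > 0" "L * (c + e) < k"
  proof
    \<comment> \<open>Dividing by \<open>L + 1\<close> instead of \<open>L\<close> covers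
      \<open>L = 0\<close>.\<close>
    show "(k - L * c) / (L + 1) > 0" using k \<open>L \<ge> 0\<close> by simp
    have "L / (L + 1) * (k - L * c) < 1 * (k - L * c)"
      using k \<open>L \<ge> 0\<close> by (intro mult_strict_right_mono) auto
    then show "L * (c + (k - L * c) / (L + 1)) < k" by (simp add: algebra_simps)
  qed
  have "\<forall>\<^sub>F y in at x within S. dist (u y) (u x) \<le> (c + e) * \<bar>y - x\<bar>"
    using assms(2) e(1) by (simp add: slope_le_def)
  moreover have "\<forall>\<^sub>F y in at x within S. y \<in> S" by (simp add: eventually_at_filter)
  ultimately show "\<forall>\<^sub>F y in at x within S. dist (g (u y)) (g (u x)) \<le> k * \<bar>y - x\<bar>"
  proof eventually_elim
    case (elim y)
    have "dist (g (u y)) (g (u x)) \<le> L * dist (u y) (u x)"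
      using assms elim by (intro lipschitz_onD) auto
    also have "\<dots> \<le> L * ((c + e) * \<bar>y - x\<bar>)"
      using elim \<open>L \<ge> 0\<close> by (intro mult_left_mono) auto
    also have "\<dots> = L * (c + e) * \<bar>y - x\<bar>" by simp
    also have "\<dots> \<le> k * \<bar>y - x\<bar>"
      using e(2) by (intro mult_right_mono) auto
    finally show ?case .
  qed
qed

lemma slope_le_Pair:
  assumes "slope_le f x S c"
  shows "slope_le (\<lambda>y. (y, f y)) x S (1 + c)"
  unfolding slope_le_def
proof (intro allI impI)
  fix k assume "k > 1 + c"
  then have "\<forall>\<^sub>F y in at x within S. dist (f y) (f x) \<le> (k - 1) * \<bar>y - x\<bar>"
    using assms by (simp add: slope_le_def)
  then show "\<forall>\<^sub>F y in at x within S. dist (y, f y) (x, f x) \<le> k * \<bar>y - x\<bar>"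
  proof eventually_elim
    case (elim y)
    have "dist (y, f y) (x, f x) \<le> \<bar>y - x\<bar> + dist (f y) (f x)"
      unfolding dist_prod_def fst_conv snd_conv dist_real_def
      using sqrt_sum_squares_le_sum_abs[of "\<bar>y - x\<bar>" "dist (f y) (f x)"] by simp
    with elim show ?case by (simp add: algebra_simps)
  qed
qed

section \<open>Mean value inequality and Gronwall estimate\<close>

text \<open>Bisection replaces the mean value theorem: for each \<open>k > c\<close> the estimate
  adds up over adjacent intervals and holds on short intervals around every point, hence globally;
  then \<open>k\<close> decreases to \<open>c\<close>.\<close>

lemma slope_le_imp_dist_le:
  fixes f :: "real \<Rightarrow> 'b::metric_space"
  assumes "p \<le> q" and slope: "\<And>x. x \<in> {p..q} \<Longrightarrow> slope_le f x {p..q} c"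
  shows "dist (f p) (f q) \<le> c * (q - p)"
proof -
  have *: "dist (f p) (f q) \<le> k * (q - p)" if "k > c" for k
  proof -
    \<comment> \<open>The guard makes \<open>P\<close> trivial on intervals reaching beyond
      \<open>{p..q}\<close>, which the local case of \<open>Bolzano\<close> includes.\<close>
    define P where "P a b \<longleftrightarrow> (p \<le> a \<and> b \<le> q \<longrightarrow> dist (f a) (f b) \<le> k * (b - a))" for a b
    have "P p q" using \<open>p \<le> q\<close>
    proof (induct rule: Bolzano)
      case (trans a b d)
      then show ?case unfolding P_def
        using dist_triangle[of "f a" "f d" "f b"] by (auto simp: algebra_simps)
    next
      case (local x)
      then have "\<forall>\<^sub>F y in at x within {p..q}. dist (f y) (f x) \<le> k * \<bar>y - x\<bar>"
        using slope that by (simp add: slope_le_def)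
      then obtain d where d: "d > 0"
        "\<And>y. y \<in> {p..q} \<Longrightarrow> y \<noteq> x \<Longrightarrow> \<bar>y - x\<bar> < d \<Longrightarrow> dist (f y) (f x) \<le> k * \<bar>y - x\<bar>"
        unfolding eventually_at dist_real_def by auto
      then have d': "dist (f y) (f x) \<le> k * \<bar>y - x\<bar>" if "y \<in> {p..q}" "\<bar>y - x\<bar> < d" for y
        using that by (cases "y = x") auto
      have "P a b" if "a \<le> x" "x \<le> b" "b - a < d" for a b
        unfolding P_def
      proof
        assume "p \<le> a \<and> b \<le> q"
        then have "dist (f a) (f x) \<le> k * (x - a)" "dist (f b) (f x) \<le> k * (b - x)"
          using d'[of a] d'[of b] that by auto
        then show "dist (f a) (f b) \<le> k * (b - a)"
          using dist_triangle2[of "f a" "f b" "f x"] by (simp add: algebra_simps)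
      qed
      then show ?case using d(1) by blast
    qed
    then show ?thesis by (simp add: P_def)
  qed
  show ?thesis
  proof (rule field_le_epsilon)
    fix e :: real assume "e > 0"
    \<comment> \<open>Then \<open>(k - c) * (q - p) \<le> e\<close>; the \<open>+ 1\<close> admits
      \<open>p = q\<close>.\<close>
    define k where "k = c + e / (q - p + 1)"
    have "dist (f p) (f q) \<le> k * (q - p)"
      using \<open>e > 0\<close> \<open>p \<le> q\<close> by (intro *) (simp add: k_def)
    also have "\<dots> \<le> c * (q - p) + e"
      using \<open>e > 0\<close> \<open>p \<le> q\<close> by (simp add: k_def field_simps)
    finally show "dist (f p) (f q) \<le> c * (q - p) + e" .
  qed
qed

text \<open>The logarithm turns a slope proportional to the function into a constant slope, as
  Gronwall requires.\<close>

lemma slope_le_ln: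
  fixes u :: "real \<Rightarrow> real"
  assumes u: "slope_le u x S c" and pos: "u x > 0" and c: "c < k * u x"
  shows "slope_le (\<lambda>y. ln (u y)) x S k"
  unfolding slope_le_def
proof (intro allI impI)
  fix k' assume k': "k' > k"
  have tu: "(u \<longlongrightarrow> u x) (at x within S)" using u by (rule slope_le_tendsto)
  have "c < k' * u x" using c mult_strict_right_mono[OF k' pos] by linarith
  \<comment> \<open>The gap below \<open>k' * u x\<close> leaves room for \<open>b\<close>, which by
    continuity also stays below \<open>k' * u y\<close> for \<open>y\<close> near
    \<open>x\<close>.\<close>
  obtain b where b: "c < b" "b < k' * u x" using dense[OF \<open>c < k' * u x\<close>] by blast
  have "((\<lambda>y. k' * min (u y) (u x)) \<longlongrightarrow> k' * min (u x) (u x)) (at x within S)"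
    by (intro tendsto_intros tu)
  then have "\<forall>\<^sub>F y in at x within S. b < k' * min (u y) (u x)"
    using b by (intro order_tendstoD) auto
  moreover have "\<forall>\<^sub>F y in at x within S. 0 < u y"
    using tu pos by (rule order_tendstoD)
  moreover have "\<forall>\<^sub>F y in at x within S. dist (u y) (u x) \<le> b * \<bar>y - x\<bar>"
    using u b by (simp add: slope_le_def)
  ultimately show "\<forall>\<^sub>F y in at x within S. dist (ln (u y)) (ln (u x)) \<le> k' * \<bar>y - x\<bar>"
  proof eventually_elim
    case (elim y)
    define m where "m = min (u y) (u x)"
    have m: "m > 0" using elim pos by (simp add: m_def)
    have "ln (u y) - ln (u x) \<le> (u y - u x) / u x" "ln (u x) - ln (u y) \<le> (u x - u y) / u y"
      using elim pos by (auto intro!: ln_diff_le)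
    moreover have "(u y - u x) / u x \<le> dist (u y) (u x) / m" "(u x - u y) / u y \<le> dist (u y) (u x) / m"
      using m elim pos unfolding m_def dist_real_def by (auto intro!: frac_le)
    ultimately have "dist (ln (u y)) (ln (u x)) \<le> dist (u y) (u x) / m"
      unfolding dist_real_def[of "ln (u y)"] by linarith
    also have "\<dots> \<le> k' * m * \<bar>y - x\<bar> / m"
    proof (rule divide_right_mono)
      have "b * \<bar>y - x\<bar> \<le> k' * m * \<bar>y - x\<bar>"
        using elim by (intro mult_right_mono) (auto simp: m_def)
      with elim show "dist (u y) (u x) \<le> k' * m * \<bar>y - x\<bar>" by linarith
    qed (use m in auto)
    also have "\<dots> = k' * \<bar>y - x\<bar>" using m by simp
    finally show ?case .
  qed
qed

text \<open>Since \<open>f\<close> may vanish, the logarithm is applied to \<open>f + e\<close>, and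
  \<open>e\<close> tends to 0 at the end. Slopes are two-sided, so \<open>s\<close> and
  \<open>t\<close> may come in either order.\<close>

lemma slope_le_gronwall:
  fixes f :: "real \<Rightarrow> real"
  assumes "k > 0" and st: "s \<in> {p..q}" "t \<in> {p..q}"
    and pos: "\<And>x. x \<in> {p..q} \<Longrightarrow> f x \<ge> 0"
    and slope: "\<And>x. x \<in> {p..q} \<Longrightarrow> slope_le f x {p..q} (k * f x)"
  shows "f s \<le> exp (k * \<bar>s - t\<bar>) * f t"
proof -
  have sub: "slope_le f x {min s t..max s t} (k * f x)" if "x \<in> {min s t..max s t}" for x
    using that st by (intro slope_le_subset[OF slope]) auto
  have *: "f s + e \<le> exp (k * \<bar>s - t\<bar>) * (f t + e)" if "e > 0" for e
  proof -
    have posx: "f x + e > 0" if "x \<in> {min s t..max s t}" for x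
      using pos[of x] that st \<open>e > 0\<close> by (auto simp: min_def max_def split: if_splits)
    have "dist (ln (f (min s t) + e)) (ln (f (max s t) + e)) \<le> k * (max s t - min s t)"
    proof (rule slope_le_imp_dist_le)
      fix x assume x: "x \<in> {min s t..max s t}"
      show "slope_le (\<lambda>x. ln (f x + e)) x {min s t..max s t} k"
      proof (rule slope_le_ln)
        show "slope_le (\<lambda>x. f x + e) x {min s t..max s t} (k * f x + 0)"
          by (intro slope_le_add sub x slope_le_const) auto
        show "k * f x + 0 < k * (f x + e)" using that \<open>k > 0\<close> by (simp add: algebra_simps)
      qed (rule posx[OF x])
    qed auto
    then have "ln (f s + e) \<le> ln (f t + e) + k * \<bar>s - t\<bar>"
      by (auto simp: dist_real_def min_def max_def split: if_splits)
    then have "exp (ln (f s + e)) \<le> exp (ln (f t + e) + k * \<bar>s - t\<bar>)" by simp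
    then show ?thesis using posx[of s] posx[of t] by (simp add: exp_add mult.commute)
  qed
  have "((\<lambda>e. f s + e) \<longlongrightarrow> f s + 0) (at_right 0)"
    and "((\<lambda>e. exp (k * \<bar>s - t\<bar>) * (f t + e)) \<longlongrightarrow> exp (k * \<bar>s - t\<bar>) * (f t + 0)) (at_right 0)"
    by (intro tendsto_intros)+
  moreover have "\<forall>\<^sub>F e in at_right 0. f s + e \<le> exp (k * \<bar>s - t\<bar>) * (f t + e)"
    using eventually_at_right_less[of "0::real"] by eventually_elim (rule *)
  ultimately have "f s + 0 \<le> exp (k * \<bar>s - t\<bar>) * (f t + 0)"
    by (intro tendsto_le[OF trivial_limit_at_right_real])
  then show ?thesis by simp
qed

section \<open>Gradient, Hessian and norms\<close>

text \<open>\<open>grad\<close> is a definite description: the vector assembled from the derivative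
  on \<open>Basis\<close> gives existence, and the inner products with all vectors give
  uniqueness.\<close>

lemma GDERIV_grad:
  assumes "f differentiable (at x)"
  shows "GDERIV f x :> grad f x"
proof -
  define D where "D = frechet_derivative f (at x)"
  have D: "(f has_derivative D) (at x)"
    using assms unfolding D_def by (simp add: frechet_derivative_works)
  then interpret bounded_linear D by (rule has_derivative_bounded_linear)
  let ?d = "\<Sum>b\<in>Basis. D b *\<^sub>R b"
  have "D h = h \<bullet> ?d" for h
  proof -
    have "D h = D (\<Sum>b\<in>Basis. (h \<bullet> b) *\<^sub>R b)" by (simp add: euclidean_representation)
    also have "\<dots> = (\<Sum>b\<in>Basis. (h \<bullet> b) * D b)" unfolding sum scaleR by simp
    also have "\<dots> = h \<bullet> ?d" by (simp add: inner_sum_right mult.commute)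
    finally show ?thesis .
  qed
  then have "D = (\<lambda>h. h \<bullet> ?d)" by (rule ext)
  with D have ex: "GDERIV f x :> ?d" unfolding gderiv_def by simp
  have uniq: "d = d'" if "GDERIV f x :> d" "GDERIV f x :> d'" for d d'
  proof -
    have "(\<lambda>h. h \<bullet> d) = (\<lambda>h. h \<bullet> d')"
      using that unfolding gderiv_def by (rule has_derivative_unique)
    then have "d \<bullet> h = d' \<bullet> h" for h by (metis inner_commute)
    then show ?thesis using vector_eq_rdot by blast
  qed
  show ?thesis
    unfolding grad_def by (rule theI[where P = "\<lambda>d. GDERIV f x :> d", OF ex]) (rule uniq[OF _ ex])
qed

lemma has_derivative_grad:
  assumes "grad f differentiable (at x)"
  shows "(grad f has_derivative blinfun_apply (hess f x)) (at x)"
proof -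
  have "(grad f has_derivative frechet_derivative (grad f) (at x)) (at x)"
    using assms by (simp add: frechet_derivative_works)
  then show ?thesis
    unfolding hess_def by (simp add: bounded_linear_Blinfun_apply has_derivative_bounded_linear)
qed

lemma norm_le_sup_norm:
  assumes "compact S" "continuous_on S f" "x \<in> S"
  shows "norm (f x) \<le> sup_norm S f"
proof -
  have "bdd_above ((\<lambda>x. norm (f x)) ` S)"
    using assms by (intro bounded_imp_bdd_above compact_imp_bounded compact_continuous_image
        continuous_on_norm)
  with assms(3) show ?thesis unfolding sup_norm_def by (rule cSUP_upper)
qed

text \<open>The infimum is attained: every quotient \<open>dist (f x) (f y) / dist x y\<close> is a
  lower bound of the admissible constants.\<close>

lemma lipschitz_on_lip_seminorm:
  assumes "L-lipschitz_on S f"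
  shows "(lip_seminorm S f)-lipschitz_on S f"
proof -
  let ?A = "{L. L-lipschitz_on S f}"
  have ne: "?A \<noteq> {}" using assms by blast
  have nonneg: "0 \<le> Inf ?A"
    using ne by (intro cInf_greatest) (auto dest: lipschitz_on_nonneg)
  show ?thesis unfolding lip_seminorm_def
  proof (intro lipschitz_onI nonneg)
    fix x y assume xy: "x \<in> S" "y \<in> S"
    show "dist (f x) (f y) \<le> Inf ?A * dist x y"
    proof (cases "x = y")
      case False
      have "dist (f x) (f y) / dist x y \<le> Inf ?A"
        using ne
      proof (rule cInf_greatest)
        fix L assume "L \<in> ?A"
        then have "dist (f x) (f y) \<le> L * dist x y" using xy by (auto intro: lipschitz_onD)
        then show "dist (f x) (f y) / dist x y \<le> L" using False by (simp add: field_simps)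
      qed
      then show ?thesis using False by (simp add: field_simps)
    qed simp
  qed
qed

text \<open>If \<open>\<bar>\<xi> x\<bar> \<le> 2 * collar_depth C c N M\<close>, the boundary is within distance \<open>c / (4 N M + 4)\<close> of \<open>x\<close>
  and \<open>E \<bullet> \<nabla>\<xi>\<close>, with Lipschitz constant \<open>2 N M\<close> in space, drops from \<open>c\<close> by at most \<open>c / 2\<close>.\<close>

definition collar_depth :: "real \<Rightarrow> real \<Rightarrow> real \<Rightarrow> real \<Rightarrow> real" where
  "collar_depth C c N M = C * (c / (4 * N * M + 4))\<^sup>2 / 4"

text \<open>The Gronwall rate. The numerator collects the variation of the factor of
  \<bar>\<xi>\<bar> in \<open>alpha\<close> and that of the added depth term; the denominator is the
  coercivity constant of \<open>alpha_hat_ge\<close>. The \<open>+ 1\<close> makes the rate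
  positive.\<close>

definition growth_rate :: "real \<Rightarrow> real \<Rightarrow> real \<Rightarrow> real \<Rightarrow> real" where
  "growth_rate C c N M =
     (4 * N * M + N + (2 * N * M + c) * N / collar_depth C c N M) / min C (c / 2) + 1"

section \<open>Setting and uniform bounds\<close>

locale outward_field =
  fixes C\<^sub>\<Omega> c\<^sub>0 :: real and \<xi> :: "'a::euclidean_space \<Rightarrow> real" and T :: real and E :: "real \<Rightarrow> 'a \<Rightarrow> 'a"
  assumes C_pos: "C\<^sub>\<Omega> > 0" and c_pos: "c\<^sub>0 > 0"
    and dom: "uniformly_convex_domain C\<^sub>\<Omega> \<xi>" and T_pos: "T > 0"
    and lipE: "\<exists>L. L-lipschitz_on ({0..T} \<times> closure (Omega \<xi>)) (\<lambda>(t, x). E t x)"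
    and outward: "\<forall>t\<in>{0..T}. \<forall>x\<in>frontier (Omega \<xi>). E t x \<bullet> grad \<xi> x \<ge> c\<^sub>0"
begin

abbreviation "D \<equiv> closure (Omega \<xi>)"

abbreviation "S\<^sub>E \<equiv> sup_norm ({0..T} \<times> D) (\<lambda>(t, x). E t x)"

definition "N = C21_norm D \<xi>"

definition "M = C01_norm ({0..T} \<times> D) (\<lambda>(t, x). E t x)"

lemma GDERIV_xi: "GDERIV \<xi> x :> grad \<xi> x"
  using dom unfolding uniformly_convex_domain_def C21_def by (blast intro: GDERIV_grad)

lemma grad_has_derivative: "(grad \<xi> has_derivative blinfun_apply (hess \<xi> x)) (at x)"
  using dom unfolding uniformly_convex_domain_def C21_def by (blast intro: has_derivative_grad)

lemma continuous_xi: "continuous_on A \<xi>"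
  using GDERIV_xi unfolding gderiv_def
  by (meson continuous_at_imp_continuous_on has_derivative_continuous)

lemma continuous_grad: "continuous_on A (grad \<xi>)"
  using grad_has_derivative
  by (meson continuous_at_imp_continuous_on has_derivative_continuous)

lemma compact_D: "compact D"
  using dom unfolding uniformly_convex_domain_def by (auto simp: compact_closure)

lemma lipschitz_hess: "(lip_seminorm D (hess \<xi>))-lipschitz_on D (hess \<xi>)"
proof -
  obtain L where "L-lipschitz_on D (hess \<xi>)"
    using dom compact_D unfolding uniformly_convex_domain_def C21_def by blast
  then show ?thesis by (rule lipschitz_on_lip_seminorm)
qed

lemma continuous_hess: "continuous_on D (hess \<xi>)"
  using lipschitz_hess by (rule lipschitz_on_continuous_on)

lemma lipschitz_E: "(lip_seminorm ({0..T} \<times> D) (\<lambda>(t, x). E t x))-lipschitz_on ({0..T} \<times> D) (\<lambda>(t, x). E t x)"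
  using lipE by (auto intro: lipschitz_on_lip_seminorm)

lemma continuous_E: "continuous_on ({0..T} \<times> D) (\<lambda>(t, x). E t x)"
  using lipschitz_E by (rule lipschitz_on_continuous_on)

lemma frontier_eq: "frontier (Omega \<xi>) = {x. \<xi> x = 0}"
  using dom by (simp add: uniformly_convex_domain_def)

lemma D_eq: "x \<in> D \<longleftrightarrow> \<xi> x \<le> 0"
  unfolding closure_Un_frontier[of "Omega \<xi>"] frontier_eq by (auto simp: Omega_def)

lemma D_nonempty: "D \<noteq> {}"
  using dom by (auto simp: uniformly_convex_domain_def)

lemma norm_E_le_sup: "t \<in> {0..T} \<Longrightarrow> x \<in> D \<Longrightarrow> norm (E t x) \<le> S\<^sub>E"
  using norm_le_sup_norm[OF compact_Times[OF compact_Icc compact_D] continuous_E, of "(t, x)"] by simp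

lemma N_bounds:
  shows N_nonneg: "0 \<le> N"
    and norm_grad_le: "x \<in> D \<Longrightarrow> norm (grad \<xi> x) \<le> N"
    and norm_hess_le: "x \<in> D \<Longrightarrow> norm (hess \<xi> x) \<le> N"
    and lipschitz_hess_N: "N-lipschitz_on D (hess \<xi>)"
proof -
  have b: "norm (\<xi> x) \<le> sup_norm D \<xi>" "norm (grad \<xi> x) \<le> sup_norm D (grad \<xi>)"
    "norm (hess \<xi> x) \<le> sup_norm D (hess \<xi>)" if "x \<in> D" for x
    using that by (intro norm_le_sup_norm compact_D continuous_xi continuous_grad continuous_hess; simp)+
  \<comment> \<open>A point of \<open>D\<close> shows that each supremum in the norm is nonnegative,
    so \<open>N\<close> dominates every summand.\<close>
  obtain x0 where "x0 \<in> D" using D_nonempty by (meson ex_in_conv)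
  note nn = b[OF this, THEN order_trans[OF norm_ge_zero]] lipschitz_on_nonneg[OF lipschitz_hess]
  show "0 \<le> N" using nn by (simp add: N_def C21_norm_def)
  show "norm (grad \<xi> x) \<le> N" "norm (hess \<xi> x) \<le> N" if "x \<in> D" for x
    using nn b[OF that] by (simp_all add: N_def C21_norm_def)
  show "N-lipschitz_on D (hess \<xi>)"
    by (rule lipschitz_on_le[OF lipschitz_hess]) (use nn in \<open>simp add: N_def C21_norm_def\<close>)
qed

lemma M_bounds:
  shows S_nonneg: "0 \<le> S\<^sub>E" and S_le_M: "S\<^sub>E \<le> M"
    and lipschitz_E_M: "M-lipschitz_on ({0..T} \<times> D) (\<lambda>(t, x). E t x)"
proof -
  obtain x0 where "x0 \<in> D" using D_nonempty by (meson ex_in_conv)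
  then have "norm (E 0 x0) \<le> S\<^sub>E" using T_pos by (intro norm_E_le_sup) auto
  then show S: "0 \<le> S\<^sub>E" using norm_ge_zero order_trans by blast
  show "S\<^sub>E \<le> M" using lipschitz_on_nonneg[OF lipschitz_E] by (simp add: M_def C01_norm_def)
  show "M-lipschitz_on ({0..T} \<times> D) (\<lambda>(t, x). E t x)"
    by (rule lipschitz_on_le[OF lipschitz_E]) (use S in \<open>simp add: M_def C01_norm_def\<close>)
qed

lemma M_nonneg: "0 \<le> M" using S_nonneg S_le_M by linarith

lemma norm_E_le: "t \<in> {0..T} \<Longrightarrow> x \<in> D \<Longrightarrow> norm (E t x) \<le> M"
  using norm_E_le_sup S_le_M by (rule order_trans)

section \<open>Convexity and the outward field near the boundary\<close>

lemma hess_ge: "x \<in> D \<Longrightarrow> v \<bullet> blinfun_apply (hess \<xi> x) v \<ge> C\<^sub>\<Omega> * (norm v)\<^sup>2"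
  using dom by (simp add: uniformly_convex_domain_def)

text \<open>Along a ray on which \<open>\<xi>\<close> does not decrease initially, convexity gives
  \<open>\<xi> (x + s e) \<ge> \<xi> x + C s\<^sup>2 / 2\<close> up to the exit time; no convexity of the set \<open>Omega \<xi>\<close> is needed.\<close>

lemma exit_point:
  assumes x: "x \<in> D"
  obtains y where "y \<in> frontier (Omega \<xi>)" "closed_segment x y \<subseteq> D" "C\<^sub>\<Omega> * (norm (x - y))\<^sup>2 \<le> 2 * \<bar>\<xi> x\<bar>"
proof -
  obtain b :: 'a where "b \<in> Basis" using nonempty_Basis by blast
  define e where "e = (if b \<bullet> grad \<xi> x \<ge> 0 then b else - b)"
  have norm_e: "norm e = 1" and e_up: "e \<bullet> grad \<xi> x \<ge> 0"
    using \<open>b \<in> Basis\<close> by (auto simp: e_def)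
  define \<phi> where "\<phi> s = \<xi> (x + s *\<^sub>R e)" for s
  have cont: "continuous_on A \<phi>" for A
    unfolding \<phi>_def by (intro continuous_on_compose2[OF continuous_xi[of UNIV]] continuous_intros) auto
  have d\<phi>: "(\<phi> has_real_derivative e \<bullet> grad \<xi> (x + s *\<^sub>R e)) (at s)" for s
  proof -
    have "(\<phi> has_derivative (\<lambda>h. (h *\<^sub>R e) \<bullet> grad \<xi> (x + s *\<^sub>R e))) (at s)"
      unfolding \<phi>_def using GDERIV_xi[unfolded gderiv_def, of "x + s *\<^sub>R e"]
      by (rule has_derivative_compose[rotated]) (auto intro!: derivative_eq_intros)
    then show ?thesis
      by (rule has_derivative_imp_has_field_derivative) simp
  qed
  have d2\<phi>: "((\<lambda>s. e \<bullet> grad \<xi> (x + s *\<^sub>R e)) has_real_derivative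
      e \<bullet> blinfun_apply (hess \<xi> (x + s *\<^sub>R e)) e) (at s)" for s
  proof -
    have "((\<lambda>s. grad \<xi> (x + s *\<^sub>R e)) has_derivative
        (\<lambda>h. blinfun_apply (hess \<xi> (x + s *\<^sub>R e)) (h *\<^sub>R e))) (at s)"
      using grad_has_derivative[of "x + s *\<^sub>R e"]
      by (rule has_derivative_compose[rotated]) (auto intro!: derivative_eq_intros)
    from has_derivative_inner_right[OF this, of e] show ?thesis
      by (rule has_derivative_imp_has_field_derivative) (simp add: blinfun.scaleR_right)
  qed
  \<comment> \<open>The ray leaves the bounded set \<open>D\<close>, so \<open>Z\<close> is
    nonempty; its infimum is the first time at which \<xi> is nonnegative on the ray.\<close>
  define Z where "Z = {r. 0 \<le> r \<and> 0 \<le> \<phi> r}"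
  have "closed Z"
    unfolding Z_def by (intro closed_Collect_conj closed_Collect_le cont continuous_intros)
  have "bounded D" using compact_D by (rule compact_imp_bounded)
  have "Z \<noteq> {}"
  proof -
    obtain R where R: "\<And>y. y \<in> D \<Longrightarrow> norm y \<le> R" using \<open>bounded D\<close> by (auto simp: bounded_iff)
    define s where "s = norm x + \<bar>R\<bar> + 1"
    have "norm (s *\<^sub>R e) - norm x \<le> norm (x + s *\<^sub>R e)"
      using norm_triangle_ineq2[of "s *\<^sub>R e" "- x"] by (simp add: add.commute)
    then have "\<not> norm (x + s *\<^sub>R e) \<le> R" using norm_e by (simp add: s_def)
    then have "x + s *\<^sub>R e \<notin> D" using R by blast
    then have "s \<in> Z" unfolding Z_def by (auto simp: D_eq \<phi>_def s_def)
    then show ?thesis by blast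
  qed
  define s where "s = Inf Z"
  have bdd: "bdd_below Z" by (auto simp: Z_def intro: bdd_belowI[of _ 0])
  have "s \<in> Z" unfolding s_def using \<open>Z \<noteq> {}\<close> bdd \<open>closed Z\<close> by (rule closed_contains_Inf)
  have neg: "\<phi> r < 0" if "0 \<le> r" "r < s" for r
    using that cInf_lower[OF _ bdd, of r] unfolding s_def Z_def by force
  have s0: "s \<ge> 0" "\<phi> s \<ge> 0" using \<open>s \<in> Z\<close> by (auto simp: Z_def)
  \<comment> \<open>Either \<open>s = 0\<close> and the start lies in \<open>D\<close>, or \<phi> is
    negative just before \<open>s\<close> and continuity applies.\<close>
  have "\<phi> s \<le> 0"
  proof (cases "s = 0")
    case True then show ?thesis using x by (simp add: \<phi>_def D_eq)
  next
    case False
    with s0 have "s > 0" by simp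
    have "(\<phi> \<longlongrightarrow> \<phi> s) (at_left s)"
      using cont[of UNIV] by (simp add: continuous_on_eq_continuous_at isCont_def filterlim_at_split)
    moreover have "\<forall>\<^sub>F r in at_left s. \<phi> r \<le> 0"
      using eventually_at_left_real[OF \<open>s > 0\<close>] by eventually_elim (simp add: neg less_imp_le)
    ultimately show ?thesis by (rule tendsto_upperbound) simp
  qed
  with s0 have \<phi>s: "\<phi> s = 0" by simp
  have inD: "x + r *\<^sub>R e \<in> D" if "0 \<le> r" "r \<le> s" for r
    using neg[of r] that \<phi>s by (cases "r = s") (auto simp: D_eq \<phi>_def)
  \<comment> \<open>The Hessian bound is integrated twice, first for the slope of \<phi>, then for
    \<phi>; the initial slope is nonnegative by the sign chosen in \<open>e\<close>.\<close>
  have up1: "C\<^sub>\<Omega> * r \<le> e \<bullet> grad \<xi> (x + r *\<^sub>R e)" if r: "0 \<le> r" "r \<le> s" for r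
  proof -
    have "e \<bullet> grad \<xi> (x + 0 *\<^sub>R e) - C\<^sub>\<Omega> * 0 \<le> e \<bullet> grad \<xi> (x + r *\<^sub>R e) - C\<^sub>\<Omega> * r"
    proof (rule DERIV_nonneg_imp_nondecreasing[OF r(1)])
      fix q assume q: "0 \<le> q" "q \<le> r"
      have "((\<lambda>s. e \<bullet> grad \<xi> (x + s *\<^sub>R e) - C\<^sub>\<Omega> * s) has_real_derivative
          e \<bullet> blinfun_apply (hess \<xi> (x + q *\<^sub>R e)) e - C\<^sub>\<Omega>) (at q)"
        by (auto intro!: derivative_eq_intros d2\<phi>)
      moreover have "0 \<le> e \<bullet> blinfun_apply (hess \<xi> (x + q *\<^sub>R e)) e - C\<^sub>\<Omega>"
        using hess_ge[OF inD, of q e] q r norm_e by simp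
      ultimately show "\<exists>d. ((\<lambda>s. e \<bullet> grad \<xi> (x + s *\<^sub>R e) - C\<^sub>\<Omega> * s) has_real_derivative d) (at q) \<and> 0 \<le> d"
        by blast
    qed
    with e_up show ?thesis by simp
  qed
  have "\<phi> 0 - C\<^sub>\<Omega> / 2 * 0\<^sup>2 \<le> \<phi> s - C\<^sub>\<Omega> / 2 * s\<^sup>2"
  proof (rule DERIV_nonneg_imp_nondecreasing[OF s0(1)])
    fix q assume q: "0 \<le> q" "q \<le> s"
    have "((\<lambda>s. \<phi> s - C\<^sub>\<Omega> / 2 * s\<^sup>2) has_real_derivative e \<bullet> grad \<xi> (x + q *\<^sub>R e) - C\<^sub>\<Omega> * q) (at q)"
      by (auto intro!: derivative_eq_intros d\<phi>)
    with up1[OF q] show "\<exists>d. ((\<lambda>s. \<phi> s - C\<^sub>\<Omega> / 2 * s\<^sup>2) has_real_derivative d) (at q) \<and> 0 \<le> d"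
      by (intro exI[of _ "e \<bullet> grad \<xi> (x + q *\<^sub>R e) - C\<^sub>\<Omega> * q"]) simp
  qed
  then have "C\<^sub>\<Omega> * s\<^sup>2 \<le> 2 * \<bar>\<xi> x\<bar>" using \<phi>s by (simp add: \<phi>_def)
  moreover have "closed_segment x (x + s *\<^sub>R e) \<subseteq> D"
  proof
    fix z assume "z \<in> closed_segment x (x + s *\<^sub>R e)"
    then obtain u where "0 \<le> u" "u \<le> 1" "z = x + (u * s) *\<^sub>R e"
      by (auto simp: in_segment algebra_simps)
    then show "z \<in> D" using s0(1) by (auto intro!: inD mult_left_le_one_le)
  qed
  ultimately show ?thesis
    using that[of "x + s *\<^sub>R e"] \<phi>s norm_e by (simp add: frontier_eq \<phi>_def)
qed

text \<open>The Hessian is controlled on \<open>D\<close>, so the mean value inequality is used on a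
  segment inside \<open>D\<close>; \<open>exit_point\<close> supplies one.\<close>

lemma grad_diff_le:
  assumes "closed_segment x y \<subseteq> D"
  shows "norm (grad \<xi> x - grad \<xi> y) \<le> N * norm (x - y)"
proof (rule differentiable_bound[OF convex_closed_segment[of x y]])
  fix z assume "z \<in> closed_segment x y"
  then show "onorm (blinfun_apply (hess \<xi> z)) \<le> N"
    using norm_hess_le assms by (auto simp: norm_blinfun.rep_eq)
  show "(grad \<xi> has_derivative blinfun_apply (hess \<xi> z)) (at z within closed_segment x y)"
    by (rule has_derivative_at_withinI[OF grad_has_derivative])
qed auto

abbreviation "\<eta> \<equiv> collar_depth C\<^sub>\<Omega> c\<^sub>0 N M"

lemma eta_pos: "\<eta> > 0"
proof -
  have "N * M \<ge> 0" using N_nonneg M_nonneg by simp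
  then have "4 * N * M + 4 > 0" by simp
  then show ?thesis using C_pos c_pos by (simp add: collar_depth_def)
qed

lemma outward_near_boundary:
  assumes t: "t \<in> {0..T}" and x: "x \<in> D" "\<bar>\<xi> x\<bar> \<le> 2 * \<eta>"
  shows "E t x \<bullet> grad \<xi> x \<ge> c\<^sub>0 / 2"
proof -
  obtain y where y: "y \<in> frontier (Omega \<xi>)" "closed_segment x y \<subseteq> D"
    "C\<^sub>\<Omega> * (norm (x - y))\<^sup>2 \<le> 2 * \<bar>\<xi> x\<bar>"
    using exit_point[OF x(1)] by blast
  have yD: "y \<in> D" using y(2) by auto
  \<comment> \<open>\<open>\<eta>\<close> equals
    \<open>C\<^sub>\<Omega> * \<rho>\<^sup>2 / 4\<close>, so depth at most \<open>2 * \<eta>\<close>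
    places the exit point within \<rho>.\<close>
  define \<rho> where "\<rho> = c\<^sub>0 / (4 * N * M + 4)"
  have NM: "N * M \<ge> 0" using N_nonneg M_nonneg by simp
  have "\<rho> \<ge> 0" using c_pos NM by (simp add: \<rho>_def)
  have "C\<^sub>\<Omega> * (norm (x - y))\<^sup>2 \<le> C\<^sub>\<Omega> * \<rho>\<^sup>2"
    using y(3) x(2) by (simp add: collar_depth_def \<rho>_def)
  then have "norm (x - y) \<le> \<rho>"
    using C_pos \<open>\<rho> \<ge> 0\<close> by (auto intro: power2_le_imp_le)
  have "dist (E t x) (E t y) \<le> M * dist x y"
    using lipschitz_onD[OF lipschitz_E_M, of "(t, x)" "(t, y)"] t x yD by (simp add: dist_Pair_Pair)
  then have dE: "norm (E t x - E t y) \<le> M * norm (x - y)" by (simp add: dist_norm)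
  \<comment> \<open>From \<open>y\<close> to \<open>x\<close>, field and gradient are changed one at
    a time; each change costs at most \<open>N * M * norm (x - y)\<close>.\<close>
  have "\<bar>(E t x - E t y) \<bullet> grad \<xi> x\<bar> \<le> (M * norm (x - y)) * N"
    by (rule order_trans[OF Cauchy_Schwarz_ineq2])
      (intro mult_mono dE norm_grad_le x mult_nonneg_nonneg M_nonneg norm_ge_zero)
  moreover have "\<bar>E t y \<bullet> (grad \<xi> x - grad \<xi> y)\<bar> \<le> M * (N * norm (x - y))"
    by (rule order_trans[OF Cauchy_Schwarz_ineq2])
      (intro mult_mono norm_E_le grad_diff_le y t yD M_nonneg norm_ge_zero)
  moreover have "E t x \<bullet> grad \<xi> x = E t y \<bullet> grad \<xi> y + (E t x - E t y) \<bullet> grad \<xi> x + E t y \<bullet> (grad \<xi> x - grad \<xi> y)"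
    by (simp add: inner_diff_left inner_diff_right)
  moreover have "E t y \<bullet> grad \<xi> y \<ge> c\<^sub>0" using outward t y(1) by blast
  moreover have "M * norm (x - y) * N = N * M * norm (x - y)" "M * (N * norm (x - y)) = N * M * norm (x - y)"
    by simp_all
  ultimately have "E t x \<bullet> grad \<xi> x \<ge> c\<^sub>0 - 2 * (N * M) * norm (x - y)"
    by linarith
  moreover have "2 * (N * M) * norm (x - y) \<le> 2 * (N * M) * \<rho>"
    using \<open>norm (x - y) \<le> \<rho>\<close> NM by (intro mult_left_mono) auto
  moreover have "2 * (N * M) * \<rho> \<le> c\<^sub>0 / 2"
    using c_pos NM by (simp add: \<rho>_def field_simps)
  ultimately show ?thesis by linarith
qed

section \<open>The corrected function and its coercivity\<close>

abbreviation "\<kappa> \<equiv> min C\<^sub>\<Omega> (c\<^sub>0 / 2)"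

abbreviation "M\<^sub>1 \<equiv> 2 * N * M + c\<^sub>0"

abbreviation "K \<equiv> growth_rate C\<^sub>\<Omega> c\<^sub>0 N M"

text \<open>The extra term vanishes near the boundary and makes the function coercive in the interior, where
  \<^const>\<open>alpha\<close> itself may be negative. Hence the differential inequality below survives
  excursions of a trajectory into the interior.\<close>

definition alpha_hat :: "real \<Rightarrow> 'a \<Rightarrow> 'a \<Rightarrow> real" where
  "alpha_hat s x v = alpha \<xi> E s x v + M\<^sub>1 * max 0 (\<bar>\<xi> x\<bar> - \<eta>)"

lemma kappa_pos: "\<kappa> > 0"
  using C_pos c_pos by simp

lemma NM_nonneg: "0 \<le> N * M"
  using N_nonneg M_nonneg by simp

lemma M1_pos: "M\<^sub>1 > 0"
  using c_pos NM_nonneg by simp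

lemma alpha_le_alpha_hat: "alpha \<xi> E s x v \<le> alpha_hat s x v"
  using M1_pos by (simp add: alpha_hat_def)

lemma alpha_hat_eq_alpha: "\<bar>\<xi> x\<bar> \<le> \<eta> \<Longrightarrow> alpha_hat s x v = alpha \<xi> E s x v"
  by (simp add: alpha_hat_def)

text \<open>Convexity controls the part quadratic in \<open>v\<close>. The field part is positive by
  the outward sign up to depth \<open>2 * \<eta>\<close>; deeper, where it may be negative, the
  added term takes over.\<close>

lemma alpha_hat_ge:
  assumes s: "s \<in> {0..T}" and x: "x \<in> D"
  shows "\<kappa> * (1 + (norm v)\<^sup>2) * \<bar>\<xi> x\<bar> \<le> alpha_hat s x v"
proof -
  have "\<kappa> * (norm v)\<^sup>2 \<le> C\<^sub>\<Omega> * (norm v)\<^sup>2" by (intro mult_right_mono) auto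
  also have "\<dots> \<le> v \<bullet> blinfun_apply (hess \<xi> x) v" using x by (rule hess_ge)
  finally have "\<kappa> * (norm v)\<^sup>2 * \<bar>\<xi> x\<bar> \<le> (v \<bullet> blinfun_apply (hess \<xi> x) v) * \<bar>\<xi> x\<bar>"
    by (rule mult_right_mono) simp
  moreover have "c\<^sub>0 / 2 * \<bar>\<xi> x\<bar> \<le> (E s x \<bullet> grad \<xi> x) * \<bar>\<xi> x\<bar> + M\<^sub>1 * max 0 (\<bar>\<xi> x\<bar> - \<eta>)"
  proof (cases "\<bar>\<xi> x\<bar> \<le> 2 * \<eta>")
    case True
    then have "c\<^sub>0 / 2 * \<bar>\<xi> x\<bar> \<le> (E s x \<bullet> grad \<xi> x) * \<bar>\<xi> x\<bar>"
      by (intro mult_right_mono outward_near_boundary s x) auto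
    moreover have "0 \<le> M\<^sub>1 * max 0 (\<bar>\<xi> x\<bar> - \<eta>)" using M1_pos by simp
    ultimately show ?thesis by linarith
  next
    case False
    have "\<bar>E s x \<bullet> grad \<xi> x\<bar> \<le> M * N"
      by (rule order_trans[OF Cauchy_Schwarz_ineq2])
        (intro mult_mono norm_E_le norm_grad_le s x M_nonneg norm_ge_zero)
    then have "- (N * M) * \<bar>\<xi> x\<bar> \<le> (E s x \<bullet> grad \<xi> x) * \<bar>\<xi> x\<bar>"
      by (intro mult_right_mono) (auto simp: mult.commute)
    \<comment> \<open>Beyond depth \<open>2 * \<eta>\<close> at least half of the depth exceeds
      \<eta>. Half of \<open>M\<^sub>1\<close> is \<open>N * M + c\<^sub>0 / 2\<close>: the first
      summand offsets the worst field term, the second is the gain.\<close>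
    moreover have "M\<^sub>1 * (\<bar>\<xi> x\<bar> / 2) \<le> M\<^sub>1 * max 0 (\<bar>\<xi> x\<bar> - \<eta>)"
      using False M1_pos by (intro mult_left_mono) auto
    ultimately show ?thesis by (simp add: algebra_simps)
  qed
  moreover have "\<kappa> * \<bar>\<xi> x\<bar> \<le> c\<^sub>0 / 2 * \<bar>\<xi> x\<bar>" by (intro mult_right_mono) auto
  moreover have "0 \<le> 1/2 * (v \<bullet> grad \<xi> x)\<^sup>2" by simp
  ultimately show ?thesis
    unfolding alpha_hat_def alpha_def distrib_right distrib_left by linarith
qed

lemma alpha_hat_nonneg: "s \<in> {0..T} \<Longrightarrow> x \<in> D \<Longrightarrow> 0 \<le> alpha_hat s x v"
  using kappa_pos by (intro order_trans[OF _ alpha_hat_ge] mult_nonneg_nonneg) auto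

section \<open>Slopes along one smooth side of a trajectory\<close>

text \<open>\<open>S\<close> will be the whole time interval or the part before or after a bounce,
  and \<open>W\<close> the velocity with its value at \<open>s\<close> set to the matching one-sided
  limit.\<close>

context
  fixes S :: "real set" and s :: real and X W :: "real \<Rightarrow> 'a"
  assumes S: "S \<subseteq> {0..T}" "s \<in> S" and img: "X ` S \<subseteq> D"
    and dX: "(X has_vector_derivative W s) (at s within S)"
    and dW: "(W has_vector_derivative E s (X s)) (at s within S)"
begin

lemma XD: "r \<in> S \<Longrightarrow> X r \<in> D"
  using img by blast

lemma sT: "s \<in> {0..T}" and XsD: "X s \<in> D"
  using S XD by auto

lemma slope_norm_velocity: "slope_le (\<lambda>r. norm (W r)) s S S\<^sub>E"
proof (rule slope_le_transform)
  show "slope_le W s S S\<^sub>E"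
    using slope_le_has_vector_derivative[OF dW] norm_E_le_sup[OF sT XsD] by (rule slope_le_mono)
  show "\<forall>\<^sub>F r in at s within S. dist (norm (W r)) (norm (W s)) \<le> dist (W r) (W s)"
    by (intro always_eventually allI) (simp add: dist_norm norm_triangle_ineq3)
qed

lemma xi_deriv: "((\<lambda>r. - \<xi> (X r)) has_real_derivative - (W s \<bullet> grad \<xi> (X s))) (at s within S)"
proof -
  have "((\<lambda>r. \<xi> (X r)) has_derivative (\<lambda>h. (h *\<^sub>R W s) \<bullet> grad \<xi> (X s))) (at s within S)"
    by (rule has_derivative_compose[OF dX[unfolded has_vector_derivative_def]
        GDERIV_xi[unfolded gderiv_def]])
  then have "((\<lambda>r. - \<xi> (X r)) has_derivative (\<lambda>h. - ((h *\<^sub>R W s) \<bullet> grad \<xi> (X s)))) (at s within S)"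
    by (rule has_derivative_minus)
  then show ?thesis by (rule has_derivative_imp_has_field_derivative) simp
qed

lemma grad_deriv:
  "((\<lambda>r. grad \<xi> (X r)) has_vector_derivative blinfun_apply (hess \<xi> (X s)) (W s)) (at s within S)"
  using has_derivative_compose[OF dX[unfolded has_vector_derivative_def] grad_has_derivative]
  by (simp add: has_vector_derivative_def blinfun.scaleR_right)

lemma normal_velocity_deriv:
  "((\<lambda>r. W r \<bullet> grad \<xi> (X r)) has_real_derivative
     W s \<bullet> blinfun_apply (hess \<xi> (X s)) (W s) + E s (X s) \<bullet> grad \<xi> (X s)) (at s within S)"
proof -
  have "((\<lambda>r. W r \<bullet> grad \<xi> (X r)) has_derivative
     (\<lambda>h. W s \<bullet> (h *\<^sub>R blinfun_apply (hess \<xi> (X s)) (W s)) + (h *\<^sub>R E s (X s)) \<bullet> grad \<xi> (X s)))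
     (at s within S)"
    using dW grad_deriv unfolding has_vector_derivative_def by (rule has_derivative_inner)
  then show ?thesis
    by (rule has_derivative_imp_has_field_derivative) (simp add: algebra_simps)
qed

lemma norm_hess_apply_le: "norm (blinfun_apply (hess \<xi> (X s)) (W s)) \<le> N * norm (W s)"
  by (rule order_trans[OF norm_blinfun]) (intro mult_right_mono norm_hess_le XsD norm_ge_zero)

text \<open>The cubic bound is factored so that \<open>1 + norm (W s)\<close> becomes the rate,
  while the other factor, times \<bar>\<xi>\<bar>, is absorbed by coercivity.\<close>

lemma slope_curvature:
  "slope_le (\<lambda>r. W r \<bullet> blinfun_apply (hess \<xi> (X r)) (W r) + E r (X r) \<bullet> grad \<xi> (X r)) s S
     ((4 * N * M + N) * (1 + norm (W s)) * (1 + (norm (W s))\<^sup>2))"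
proof -
  define w where "w = norm (W s)"
  have w: "w \<ge> 0" by (simp add: w_def)
  have slX: "slope_le X s S w"
    unfolding w_def by (rule slope_le_has_vector_derivative[OF dX])
  have slW: "slope_le W s S M"
    using slope_le_has_vector_derivative[OF dW] norm_E_le[OF sT XsD] by (rule slope_le_mono)
  have slH: "slope_le (\<lambda>r. hess \<xi> (X r)) s S (N * w)"
    using lipschitz_hess_N slX XD S(2) by (rule slope_le_lipschitz_on)
  have slg: "slope_le (\<lambda>r. grad \<xi> (X r)) s S (N * w)"
    using slope_le_has_vector_derivative[OF grad_deriv] norm_hess_apply_le
    unfolding w_def by (rule slope_le_mono)
  \<comment> \<open>The field is Lipschitz jointly in time and space, so it is composed with the
    graph of \<open>X\<close>, whose speed is at most \<open>1 + w\<close>.\<close>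
  have "slope_le (\<lambda>r. (\<lambda>(t, x). E t x) (r, X r)) s S (M * (1 + w))"
    by (rule slope_le_lipschitz_on[OF lipschitz_E_M slope_le_Pair[OF slX]]) (use S XD in auto)
  then have slE: "slope_le (\<lambda>r. E r (X r)) s S (M * (1 + w))" by simp
  have "slope_le (\<lambda>r. blinfun_apply (hess \<xi> (X r)) (W r)) s S (norm (hess \<xi> (X s)) * M + N * w * norm (W s))"
    by (rule slope_le_prod[OF bounded_bilinear_blinfun_apply norm_blinfun slH slW])
  moreover have "norm (hess \<xi> (X s)) * M + N * w * norm (W s) \<le> N * M + N * w * w"
    using norm_hess_le[OF XsD] M_nonneg by (simp add: w_def mult_right_mono)
  ultimately have slHW: "slope_le (\<lambda>r. blinfun_apply (hess \<xi> (X r)) (W r)) s S (N * M + N * w * w)"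
    by (rule slope_le_mono)
  have "slope_le (\<lambda>r. W r \<bullet> blinfun_apply (hess \<xi> (X r)) (W r)) s S
      (norm (W s) * (N * M + N * w * w) + M * norm (blinfun_apply (hess \<xi> (X s)) (W s)))"
    by (rule slope_le_prod[OF bounded_bilinear_inner _ slW slHW]) (simp add: Cauchy_Schwarz_ineq2)
  moreover have "norm (W s) * (N * M + N * w * w) + M * norm (blinfun_apply (hess \<xi> (X s)) (W s))
      \<le> w * (N * M + N * w * w) + M * (N * w)"
    unfolding w_def by (intro add_left_mono mult_left_mono norm_hess_apply_le M_nonneg)
  ultimately have sl1: "slope_le (\<lambda>r. W r \<bullet> blinfun_apply (hess \<xi> (X r)) (W r)) s S
      (w * (N * M + N * w * w) + M * (N * w))"
    by (rule slope_le_mono)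
  have "slope_le (\<lambda>r. E r (X r) \<bullet> grad \<xi> (X r)) s S
      (norm (E s (X s)) * (N * w) + M * (1 + w) * norm (grad \<xi> (X s)))"
    by (rule slope_le_prod[OF bounded_bilinear_inner _ slE slg]) (simp add: Cauchy_Schwarz_ineq2)
  moreover have "norm (E s (X s)) * (N * w) + M * (1 + w) * norm (grad \<xi> (X s))
      \<le> M * (N * w) + M * (1 + w) * N"
    by (intro add_mono mult_left_mono mult_right_mono norm_E_le norm_grad_le sT XsD
        mult_nonneg_nonneg M_nonneg N_nonneg) (use w in simp_all)
  ultimately have sl2: "slope_le (\<lambda>r. E r (X r) \<bullet> grad \<xi> (X r)) s S (M * (N * w) + M * (1 + w) * N)"
    by (rule slope_le_mono)
  have "w * (N * M + N * w * w) + M * (N * w) + (M * (N * w) + M * (1 + w) * N)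
      = N * M * (1 + 4 * w) + N * w ^ 3"
    by (simp add: algebra_simps power3_eq_cube)
  also have "\<dots> \<le> N * M * (4 * ((1 + w) * (1 + w\<^sup>2))) + N * ((1 + w) * (1 + w\<^sup>2))"
  proof (intro add_mono mult_left_mono NM_nonneg N_nonneg)
    have "(1 + w) * (1 + w\<^sup>2) = 1 + w + w\<^sup>2 + w ^ 3"
      by (simp add: algebra_simps power2_eq_square power3_eq_cube)
    then show "1 + 4 * w \<le> 4 * ((1 + w) * (1 + w\<^sup>2))" "w ^ 3 \<le> (1 + w) * (1 + w\<^sup>2)"
      using w by (auto simp: add_nonneg_nonneg)
  qed
  also have "\<dots> = (4 * N * M + N) * (1 + w) * (1 + w\<^sup>2)" by (simp add: algebra_simps)
  finally show ?thesis
    unfolding w_def[symmetric] by (rule slope_le_mono[OF slope_le_add[OF sl1 sl2]])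
qed

text \<open>At depth below \<eta> the term vanishes nearby. Deeper, the factor \<bar>\<xi>\<bar> /
  \<eta> is at least 1 and may be inserted, which makes the bound proportional to \<bar>\<xi>\<bar>
  like the other contributions.\<close>

lemma slope_depth:
  "slope_le (\<lambda>r. M\<^sub>1 * max 0 (- \<xi> (X r) - \<eta>)) s S (M\<^sub>1 * (N * norm (W s) * (\<bar>\<xi> (X s)\<bar> / \<eta>)))"
proof (cases "\<bar>\<xi> (X s)\<bar> < \<eta>")
  case True
  have "((\<lambda>r. - \<xi> (X r)) \<longlongrightarrow> - \<xi> (X s)) (at s within S)"
    using xi_deriv by (meson DERIV_continuous continuous_within)
  then have "\<forall>\<^sub>F r in at s within S. - \<xi> (X r) < \<eta>"
    by (rule order_tendstoD) (use True in auto)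
  then have "\<forall>\<^sub>F r in at s within S. dist (M\<^sub>1 * max 0 (- \<xi> (X r) - \<eta>)) (M\<^sub>1 * max 0 (- \<xi> (X s) - \<eta>)) \<le> dist (0::real) 0"
    by eventually_elim (use True in auto)
  moreover have "0 \<le> M\<^sub>1 * (N * norm (W s) * (\<bar>\<xi> (X s)\<bar> / \<eta>))"
    using eta_pos M1_pos N_nonneg by (intro mult_nonneg_nonneg divide_nonneg_nonneg) auto
  ultimately show ?thesis
    by (intro slope_le_transform[OF slope_le_const[of _ "0::real"]])
next
  case False
  have "M\<^sub>1-lipschitz_on UNIV (\<lambda>r. M\<^sub>1 * max 0 (r - \<eta>))"
  proof (rule lipschitz_onI)
    fix a b :: real
    have "dist (M\<^sub>1 * max 0 (a - \<eta>)) (M\<^sub>1 * max 0 (b - \<eta>)) = M\<^sub>1 * \<bar>max 0 (a - \<eta>) - max 0 (b - \<eta>)\<bar>"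
      using M1_pos by (simp add: dist_real_def abs_mult flip: right_diff_distrib)
    also have "\<dots> \<le> M\<^sub>1 * \<bar>a - b\<bar>" using M1_pos by (intro mult_left_mono) auto
    finally show "dist (M\<^sub>1 * max 0 (a - \<eta>)) (M\<^sub>1 * max 0 (b - \<eta>)) \<le> M\<^sub>1 * dist a b"
      by (simp add: dist_real_def)
  qed (use M1_pos in simp)
  moreover have "slope_le (\<lambda>r. - \<xi> (X r)) s S (norm (- (W s \<bullet> grad \<xi> (X s))))"
    using xi_deriv by (intro slope_le_has_vector_derivative)
      (simp add: has_real_derivative_iff_has_vector_derivative)
  ultimately have "slope_le (\<lambda>r. M\<^sub>1 * max 0 (- \<xi> (X r) - \<eta>)) s S (M\<^sub>1 * norm (- (W s \<bullet> grad \<xi> (X s))))"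
    by (rule slope_le_lipschitz_on) (use S in auto)
  moreover have "norm (- (W s \<bullet> grad \<xi> (X s))) \<le> N * norm (W s) * (\<bar>\<xi> (X s)\<bar> / \<eta>)"
  proof -
    have "norm (- (W s \<bullet> grad \<xi> (X s))) \<le> norm (W s) * norm (grad \<xi> (X s))"
      by (simp add: Cauchy_Schwarz_ineq2)
    also have "\<dots> \<le> norm (W s) * N" by (intro mult_left_mono norm_grad_le XsD) simp
    also have "\<dots> \<le> N * norm (W s) * (\<bar>\<xi> (X s)\<bar> / \<eta>)"
      using False eta_pos N_nonneg mult_left_mono[of 1 "\<bar>\<xi> (X s)\<bar> / \<eta>" "N * norm (W s)"]
      by (simp add: mult.commute)
    finally show ?thesis .
  qed
  ultimately show ?thesis
    using M1_pos by (elim slope_le_mono mult_left_mono) simp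
qed

text \<open>With \<open>r = \<bar>\<xi>\<bar>\<close>, \<open>p = v \<bullet> \<nabla>\<xi>\<close> and \<open>q\<close> the factor of \<open>r\<close> in \<^const>\<open>alpha\<close>, one has
  \<open>p' = q\<close> and \<open>r' = - p\<close>. So \<open>p\<^sup>2 / 2 + q s * r\<close>, with \<open>q\<close> frozen at time \<open>s\<close>, is stationary at \<open>s\<close>,
  and only the variation of \<open>q\<close>, multiplied by \<open>r\<close>, contributes.\<close>

lemma slope_alpha_hat:
  "slope_le (\<lambda>r. alpha_hat r (X r) (W r)) s S (K * (1 + norm (W s)) * alpha_hat s (X s) (W s))"
proof -
  define w where "w = norm (W s)"
  define p where "p r = W r \<bullet> grad \<xi> (X r)" for r
  define q where "q r = W r \<bullet> blinfun_apply (hess \<xi> (X r)) (W r) + E r (X r) \<bullet> grad \<xi> (X r)" for r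
  define \<rho> where "\<rho> r = - \<xi> (X r)" for r
  define B where "B = (4 * N * M + N) * (1 + w) * (1 + w\<^sup>2)"
  have \<rho>: "\<bar>\<xi> (X r)\<bar> = \<rho> r" if "r \<in> S" for r
    using XD[OF that] by (simp add: D_eq \<rho>_def)
  have dp: "(p has_real_derivative q s) (at s within S)"
    unfolding p_def q_def by (rule normal_velocity_deriv)
  have d\<rho>: "(\<rho> has_real_derivative - p s) (at s within S)"
    unfolding p_def \<rho>_def by (rule xi_deriv)
  have "((\<lambda>r. 1/2 * (p r)\<^sup>2 + q s * \<rho> r) has_real_derivative 0) (at s within S)"
    by (auto intro!: derivative_eq_intros dp d\<rho>)
  then have sl1: "slope_le (\<lambda>r. 1/2 * (p r)\<^sup>2 + q s * \<rho> r) s S 0"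
    using slope_le_has_vector_derivative
    by (fastforce simp: has_real_derivative_iff_has_vector_derivative)
  \<comment> \<open>The increment of \<open>q\<close> vanishes at \<open>s\<close>, so in its
    product with \<open>\<rho>\<close> the slope of \<open>\<rho>\<close> drops out.\<close>
  have "slope_le (\<lambda>r. q r + - q s) s S (B + 0)"
    unfolding q_def B_def w_def by (intro slope_le_add slope_curvature slope_le_const) simp
  moreover have "slope_le \<rho> s S (norm (- p s))"
    using d\<rho> by (intro slope_le_has_vector_derivative)
      (simp add: has_real_derivative_iff_has_vector_derivative)
  ultimately have "slope_le (\<lambda>r. (q r + - q s) * \<rho> r) s S
      (norm (q s + - q s) * norm (- p s) + (B + 0) * norm (\<rho> s))"
    by (intro slope_le_prod[OF bounded_bilinear_mult]) (auto simp: abs_mult)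
  then have sl2: "slope_le (\<lambda>r. (q r + - q s) * \<rho> r) s S (B * \<rho> s)"
    using \<rho>[OF S(2)] by simp
  have sl3: "slope_le (\<lambda>r. M\<^sub>1 * max 0 (\<rho> r - \<eta>)) s S (M\<^sub>1 * (N * w * (\<rho> s / \<eta>)))"
    using slope_depth \<rho>[OF S(2)] by (simp add: \<rho>_def w_def)
  have eq: "alpha_hat r (X r) (W r)
      = 1/2 * (p r)\<^sup>2 + q s * \<rho> r + (q r + - q s) * \<rho> r + M\<^sub>1 * max 0 (\<rho> r - \<eta>)" if "r \<in> S" for r
    using \<rho>[OF that] by (simp add: alpha_hat_def alpha_def p_def q_def algebra_simps)
  have sl: "slope_le (\<lambda>r. alpha_hat r (X r) (W r)) s S (0 + B * \<rho> s + M\<^sub>1 * (N * w * (\<rho> s / \<eta>)))"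
    by (rule slope_le_transform[OF slope_le_add[OF slope_le_add[OF sl1 sl2] sl3]])
      (use S(2) in \<open>simp add: eventually_at_filter eq\<close>)
  have w: "w \<ge> 0" by (simp add: w_def)
  have \<rho>s: "\<rho> s \<ge> 0" using \<rho>[OF S(2)] by simp
  \<comment> \<open>\<open>K\<close> is \<open>A / \<kappa> + 1\<close>.\<close>
  define A where "A = 4 * N * M + N + M\<^sub>1 * N / \<eta>"
  have A: "A \<ge> 0" and MN: "M\<^sub>1 * N / \<eta> \<ge> 0"
    using NM_nonneg N_nonneg M1_pos eta_pos by (auto simp: A_def)
  have "M\<^sub>1 * N / \<eta> * w \<le> M\<^sub>1 * N / \<eta> * ((1 + w) * (1 + w\<^sup>2))"
    using w MN by (intro mult_left_mono) (auto simp: algebra_simps)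
  then have "M\<^sub>1 * N / \<eta> * w * \<rho> s \<le> M\<^sub>1 * N / \<eta> * ((1 + w) * (1 + w\<^sup>2)) * \<rho> s"
    using \<rho>s by (rule mult_right_mono)
  then have "0 + B * \<rho> s + M\<^sub>1 * (N * w * (\<rho> s / \<eta>)) \<le> A * ((1 + w) * (1 + w\<^sup>2)) * \<rho> s"
    unfolding A_def B_def by (simp add: algebra_simps)
  \<comment> \<open>Coercivity trades \<open>(1 + w\<^sup>2) * \<rho> s\<close> for
    \<open>alpha_hat\<close>, leaving only \<open>1 + w\<close> in the rate.\<close>
  also have "\<dots> = A / \<kappa> * (1 + w) * (\<kappa> * (1 + w\<^sup>2) * \<rho> s)"
    using less_imp_neq[OF kappa_pos] by simp
  also have "\<dots> \<le> A / \<kappa> * (1 + w) * alpha_hat s (X s) (W s)"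
    using alpha_hat_ge[OF sT XsD, of "W s"] w A kappa_pos \<rho>[OF S(2)]
    by (intro mult_left_mono) (auto simp: w_def)
  also have "\<dots> \<le> K * (1 + w) * alpha_hat s (X s) (W s)"
    using w alpha_hat_nonneg[OF sT XsD]
    by (intro mult_right_mono) (auto simp: growth_rate_def A_def)
  finally show ?thesis using sl unfolding w_def by (rule slope_le_mono[rotated])
qed

end

section \<open>Reflection and growth along trajectories\<close>

text \<open>Reflection in a unit normal is an isometry that reverses the normal component. Its
  square is all that \<open>alpha\<close> sees at the boundary, where \<bar>\<xi>\<bar>
  vanishes.\<close>

lemma reflection:
  assumes "x \<in> frontier (Omega \<xi>)" and w': "w' = w - (2 * (normal \<xi> x \<bullet> w)) *\<^sub>R normal \<xi> x"
  shows "norm w' = norm w" "(w' \<bullet> grad \<xi> x)\<^sup>2 = (w \<bullet> grad \<xi> x)\<^sup>2"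
proof -
  define n where "n = normal \<xi> x"
  have "grad \<xi> x \<noteq> 0" using assms(1) dom by (auto simp: uniformly_convex_domain_def)
  then have nn: "n \<bullet> n = 1" and g: "grad \<xi> x = norm (grad \<xi> x) *\<^sub>R n"
    by (auto simp: n_def normal_def simp flip: power2_norm_eq_inner)
  have "w' \<bullet> w' = w \<bullet> w"
    unfolding w' n_def[symmetric]
    by (simp add: inner_diff_left inner_diff_right nn inner_commute[of w n])
  then show "norm w' = norm w" by (simp add: norm_eq_sqrt_inner)
  have "w' \<bullet> n = - (w \<bullet> n)"
    unfolding w' n_def[symmetric] by (simp add: inner_diff_left nn inner_commute[of w n])
  then have "w' \<bullet> grad \<xi> x = - (w \<bullet> grad \<xi> x)" by (subst (1 2) g) simp
  then show "(w' \<bullet> grad \<xi> x)\<^sup>2 = (w \<bullet> grad \<xi> x)\<^sup>2" by simp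
qed

text \<open>At a boundary time the smooth estimates apply on each side to the velocity redefined
  there; by \<open>reflection\<close> this changes neither the speed nor \<open>alpha_hat\<close>,
  so the two sides can be glued.\<close>

lemma characteristic_slopes:
  assumes ch: "characteristic \<xi> T E t x v X V" and s: "s \<in> {0..T}"
  shows "slope_le (\<lambda>r. norm (V r)) s {0..T} S\<^sub>E"
    and "slope_le (\<lambda>r. alpha_hat r (X r) (V r)) s {0..T} (K * (1 + norm (V s)) * alpha_hat s (X s) (V s))"
proof -
  have img: "X ` {0..T} \<subseteq> D"
    using ch unfolding characteristic_def by blast
  have "slope_le (\<lambda>r. norm (V r)) s {0..T} S\<^sub>E \<and>
    slope_le (\<lambda>r. alpha_hat r (X r) (V r)) s {0..T} (K * (1 + norm (V s)) * alpha_hat s (X s) (V s))"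
  proof (cases "X s \<in> Omega \<xi>")
    case True
    then have "(X has_vector_derivative V s) (at s within {0..T})"
      "(V has_vector_derivative E s (X s)) (at s within {0..T})"
      using ch s unfolding characteristic_def by blast+
    with slope_norm_velocity[OF subset_refl s img] slope_alpha_hat[OF subset_refl s img]
    show ?thesis by blast
  next
    case False
    moreover have "X s \<in> D" using img s by blast
    ultimately have fr: "X s \<in> frontier (Omega \<xi>)" by (simp add: closure_Un_frontier)
    then obtain w w' where w: "V s \<in> {w, w'}"
      and w': "w' = w - (2 * (normal \<xi> (X s) \<bullet> w)) *\<^sub>R normal \<xi> (X s)"
      and left: "(X has_vector_derivative w) (at s within {0..s})"
        "(V(s := w) has_vector_derivative E s (X s)) (at s within {0..s})"
      and right: "(X has_vector_derivative w') (at s within {s..T})"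
        "(V(s := w') has_vector_derivative E s (X s)) (at s within {s..T})"
      using ch s unfolding characteristic_def by blast
    have one_sided: "slope_le (\<lambda>r. norm (V r)) s S S\<^sub>E \<and>
        slope_le (\<lambda>r. alpha_hat r (X r) (V r)) s S (K * (1 + norm (V s)) * alpha_hat s (X s) (V s))"
      if S: "S \<subseteq> {0..T}" "s \<in> S" and u: "u \<in> {w, w'}"
        and dX: "(X has_vector_derivative u) (at s within S)"
        and dV: "(V(s := u) has_vector_derivative E s (X s)) (at s within S)" for S u
    proof -
      have "norm u = norm (V s)" "(u \<bullet> grad \<xi> (X s))\<^sup>2 = (V s \<bullet> grad \<xi> (X s))\<^sup>2"
        using u w reflection[OF fr w'] by auto
      moreover from this(2) have "alpha_hat s (X s) u = alpha_hat s (X s) (V s)"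
        using fr by (simp add: alpha_hat_def alpha_def frontier_eq)
      ultimately have eq: "(\<lambda>r. norm ((V(s := u)) r)) = (\<lambda>r. norm (V r))"
        "(\<lambda>r. alpha_hat r (X r) ((V(s := u)) r)) = (\<lambda>r. alpha_hat r (X r) (V r))"
        "norm ((V(s := u)) s) = norm (V s)"
        "alpha_hat s (X s) ((V(s := u)) s) = alpha_hat s (X s) (V s)"
        by (auto simp: fun_eq_iff)
      have dX': "(X has_vector_derivative (V(s := u)) s) (at s within S)" using dX by simp
      have img': "X ` S \<subseteq> D" using img S(1) by blast
      show ?thesis
        using slope_norm_velocity[OF S img' dX' dV] slope_alpha_hat[OF S img' dX' dV]
        unfolding eq by blast
    qed
    have T: "{0..T} = {0..s} \<union> {s..T}" using s by auto
    have glue: "slope_le f s {0..T} c" if "slope_le f s {0..s} c" "slope_le f s {s..T} c"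
      for f :: "real \<Rightarrow> real" and c
      using that by (subst T) (rule slope_le_Un)
    show ?thesis
      using one_sided[OF _ _ _ left] one_sided[OF _ _ _ right] s by (intro conjI glue) auto
  qed
  then show "slope_le (\<lambda>r. norm (V r)) s {0..T} S\<^sub>E"
    and "slope_le (\<lambda>r. alpha_hat r (X r) (V r)) s {0..T} (K * (1 + norm (V s)) * alpha_hat s (X s) (V s))"
    by blast+
qed

lemma K_pos: "K > 0"
  unfolding growth_rate_def using kappa_pos NM_nonneg N_nonneg M_nonneg M1_pos eta_pos
  by (intro add_nonneg_pos divide_nonneg_nonneg add_nonneg_nonneg mult_nonneg_nonneg) auto

text \<open>Taking \<open>(a, b)\<close> as \<open>(s, t)\<close> yields the upper estimate, as
  \<open>(t, s)\<close> the lower one. One of them is \<open>t\<close>, since the speed is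
  controlled from \<open>v\<close>.\<close>

lemma alpha_hat_growth:
  assumes ch: "characteristic \<xi> T E t x v X V" and t: "t \<in> {0..T}"
    and ab: "a \<in> {0..T}" "b \<in> {0..T}" "\<bar>a - b\<bar> = \<bar>s - t\<bar>" "t \<in> {a, b}"
  shows "alpha_hat a (X a) (V a)
    \<le> exp (K * ((norm v + 1) * \<bar>s - t\<bar> + S\<^sub>E * (s - t)\<^sup>2)) * alpha_hat b (X b) (V b)"
proof -
  define p q where "p = min a b" and "q = max a b"
  have pq: "{p..q} \<subseteq> {0..T}" "t \<in> {p..q}" "p \<le> q" "q - p = \<bar>s - t\<bar>" using ab by (auto simp: p_def q_def)
  have XD: "X r \<in> D" if "r \<in> {0..T}" for r
    using ch that unfolding characteristic_def by blast
  have Vt: "V t = v" using ch by (simp add: characteristic_def)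
  \<comment> \<open>\<open>k\<close> is \<open>K\<close> times one plus a bound on the speed between
    \<open>a\<close> and \<open>b\<close>; times the duration, it produces the quadratic term of the
    exponent.\<close>
  define k where "k = K * (1 + norm v + S\<^sub>E * \<bar>s - t\<bar>)"
  have "1 + norm v + S\<^sub>E * \<bar>s - t\<bar> > 0"
    using S_nonneg by (intro add_pos_nonneg mult_nonneg_nonneg) auto
  then have "k > 0" using K_pos by (simp add: k_def)
  have nV: "norm (V r) \<le> norm v + S\<^sub>E * \<bar>s - t\<bar>" if r: "r \<in> {p..q}" for r
  proof -
    have "dist (norm (V (min r t))) (norm (V (max r t))) \<le> S\<^sub>E * (max r t - min r t)"
    proof (rule slope_le_imp_dist_le)
      fix y assume "y \<in> {min r t..max r t}"
      moreover have "{min r t..max r t} \<subseteq> {0..T}" using r pq(1,2) by auto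
      ultimately show "slope_le (\<lambda>r. norm (V r)) y {min r t..max r t} S\<^sub>E"
        by (blast intro: slope_le_subset characteristic_slopes(1)[OF ch])
    qed auto
    then have "norm (V r) \<le> norm v + S\<^sub>E * \<bar>r - t\<bar>"
      by (auto simp: dist_real_def min_def max_def Vt split: if_splits)
    also have "\<dots> \<le> norm v + S\<^sub>E * \<bar>s - t\<bar>"
      using r pq S_nonneg by (intro add_left_mono mult_left_mono) auto
    finally show ?thesis .
  qed
  have "alpha_hat a (X a) (V a) \<le> exp (k * \<bar>a - b\<bar>) * alpha_hat b (X b) (V b)"
  proof (rule slope_le_gronwall[OF \<open>k > 0\<close>, of _ p q])
    fix r assume r: "r \<in> {p..q}"
    then have rT: "r \<in> {0..T}" using pq(1) by blast
    show pos: "0 \<le> alpha_hat r (X r) (V r)" using rT XD by (intro alpha_hat_nonneg)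
    have "K * (1 + norm (V r)) * alpha_hat r (X r) (V r) \<le> k * alpha_hat r (X r) (V r)"
      unfolding k_def using nV[OF r] K_pos pos by (intro mult_right_mono mult_left_mono) auto
    with slope_le_subset[OF characteristic_slopes(2)[OF ch rT] pq(1)]
    show "slope_le (\<lambda>r. alpha_hat r (X r) (V r)) r {p..q} (k * alpha_hat r (X r) (V r))"
      by (rule slope_le_mono)
  qed (auto simp: p_def q_def)
  moreover have "k * \<bar>a - b\<bar> = K * ((norm v + 1) * \<bar>s - t\<bar> + S\<^sub>E * (s - t)\<^sup>2)"
  proof -
    have "(s - t)\<^sup>2 = \<bar>s - t\<bar> * \<bar>s - t\<bar>" by (simp add: power2_eq_square)
    then show ?thesis unfolding k_def ab(3) by (simp only: algebra_simps)
  qed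
  ultimately show ?thesis by simp
qed

section \<open>Collar and kinetic distance\<close>

text \<open>The collar is measured by distance, the added term by \<bar>\<xi>\<bar>; uniform
  continuity on the compact \<open>D\<close>, applied with a nearest boundary point, links the
  two.\<close>

lemma collar_shallow:
  obtains \<delta> where "\<delta> > 0" "\<And>x. x \<in> collar \<xi> \<delta> \<Longrightarrow> x \<in> D \<and> \<bar>\<xi> x\<bar> \<le> \<eta>"
proof -
  have "uniformly_continuous_on D \<xi>"
    using compact_uniformly_continuous[OF continuous_xi compact_D] .
  then obtain \<delta> where \<delta>: "\<delta> > 0" "\<And>x y. x \<in> D \<Longrightarrow> y \<in> D \<Longrightarrow> dist y x < \<delta> \<Longrightarrow> dist (\<xi> y) (\<xi> x) < \<eta>"
    using eta_pos unfolding uniformly_continuous_on_def by metis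
  have "x \<in> D \<and> \<bar>\<xi> x\<bar> \<le> \<eta>" if x: "x \<in> collar \<xi> \<delta>" for x
  proof -
    have xD: "x \<in> D" and d: "infdist x (frontier (Omega \<xi>)) < \<delta>" using x by (auto simp: collar_def)
    obtain z where "z \<in> frontier (Omega \<xi>)" using exit_point[OF xD] by blast
    then obtain y where y: "y \<in> frontier (Omega \<xi>)" "infdist x (frontier (Omega \<xi>)) = dist x y"
      using infdist_attains_inf[OF frontier_closed] by blast
    have "\<xi> y = 0" using y(1) by (simp add: frontier_eq)
    then show ?thesis
      using \<delta>(2)[of y x] xD d y(2) by (simp add: D_eq dist_real_def)
  qed
  with \<delta>(1) show ?thesis by (rule that)
qed

lemma continuous_alpha: "continuous_on ({0..T} \<times> D \<times> UNIV) (\<lambda>(t, x, v). alpha \<xi> E t x v)"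
proof -
  let ?A = "{0..T} \<times> D \<times> (UNIV :: 'a set)"
  have x: "continuous_on ?A (\<lambda>z. fst (snd z))" and v: "continuous_on ?A (\<lambda>z. snd (snd z))"
    by (intro continuous_intros)+
  have g: "continuous_on ?A (\<lambda>z. grad \<xi> (fst (snd z)))"
    by (rule continuous_on_compose2[OF continuous_grad[of UNIV] x]) simp
  have xi: "continuous_on ?A (\<lambda>z. \<xi> (fst (snd z)))"
    by (rule continuous_on_compose2[OF continuous_xi[of UNIV] x]) simp
  have h: "continuous_on ?A (\<lambda>z. hess \<xi> (fst (snd z)))"
    by (rule continuous_on_compose2[OF continuous_hess x]) auto
  have "continuous_on ?A (\<lambda>z. (\<lambda>(t, x). E t x) (fst z, fst (snd z)))"
    by (rule continuous_on_compose2[OF continuous_E]) (auto intro!: continuous_intros)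
  then have e: "continuous_on ?A (\<lambda>z. E (fst z) (fst (snd z)))" by simp
  have "continuous_on ?A (\<lambda>z. alpha \<xi> E (fst z) (fst (snd z)) (snd (snd z)))"
    unfolding alpha_def by (intro continuous_intros x v g xi h e)
  then show ?thesis by (simp add: case_prod_beta)
qed

text \<open>In the collar \<open>alpha\<close> is \<open>alpha_hat\<close>, so coercivity makes it
  nonnegative with zeros only on the boundary, where just half of
  \<open>(v \<bullet> grad \<xi> x)\<^sup>2\<close> remains.\<close>

lemma kinetic_distance_alpha:
  assumes shallow: "\<And>x. x \<in> collar \<xi> \<delta> \<Longrightarrow> x \<in> D \<and> \<bar>\<xi> x\<bar> \<le> \<eta>"
  shows "kinetic_distance \<xi> T \<delta> (alpha \<xi> E)"
  unfolding kinetic_distance_def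
proof (intro conjI continuous_alpha ballI allI)
  fix t x and v :: 'a assume t: "t \<in> {0..T}" and x: "x \<in> collar \<xi> \<delta>"
  have xD: "x \<in> D" and eq: "alpha_hat t x v = alpha \<xi> E t x v"
    using shallow[OF x] by (auto simp: alpha_hat_eq_alpha)
  show "0 \<le> alpha \<xi> E t x v" using alpha_hat_nonneg[OF t xD] eq by metis
  have boundary: "\<xi> x = 0" if "alpha \<xi> E t x v = 0"
  proof -
    have "\<kappa> * (1 + (norm v)\<^sup>2) * \<bar>\<xi> x\<bar> \<le> 0" using alpha_hat_ge[OF t xD, of v] eq that by simp
    moreover have "\<kappa> * (1 + (norm v)\<^sup>2) > 0"
      using kappa_pos by (intro mult_pos_pos add_pos_nonneg) auto
    ultimately show ?thesis
      using mult_pos_pos[of "\<kappa> * (1 + (norm v)\<^sup>2)" "\<bar>\<xi> x\<bar>"] by linarith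
  qed
  have "v \<bullet> normal \<xi> x = 0 \<longleftrightarrow> v \<bullet> grad \<xi> x = 0" by (auto simp: normal_def)
  then show "alpha \<xi> E t x v = 0 \<longleftrightarrow> (x, v) \<in> grazing_set \<xi>"
    using boundary by (auto simp: grazing_set_def frontier_eq alpha_def)
qed

end

section \<open>The two estimates with a uniform constant\<close>

theorem lemma3p2:
  fixes C\<^sub>\<Omega> c\<^sub>0 :: real
  assumes "C\<^sub>\<Omega> > 0" and "c\<^sub>0 > 0"
  shows "\<exists>C\<^sub>0 :: real \<Rightarrow> real \<Rightarrow> real.
    \<forall>(\<xi> :: 'a::euclidean_space \<Rightarrow> real) (T :: real) (E :: real \<Rightarrow> 'a \<Rightarrow> 'a).
      uniformly_convex_domain C\<^sub>\<Omega> \<xi> \<longrightarrow> T > 0 \<longrightarrow>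
      (\<exists>L. L-lipschitz_on ({0..T} \<times> closure (Omega \<xi>)) (\<lambda>(t, x). E t x)) \<longrightarrow>
      (\<forall>t\<in>{0..T}. \<forall>x\<in>frontier (Omega \<xi>). E t x \<bullet> grad \<xi> x \<ge> c\<^sub>0) \<longrightarrow>
      (\<exists>\<delta>>0.
         kinetic_distance \<xi> T \<delta> (alpha \<xi> E) \<and>
         (\<forall>t\<in>{0..T}. \<forall>x\<in>collar \<xi> \<delta>. \<forall>v. \<forall>s\<in>{0..T}. \<forall>X V.
            characteristic \<xi> T E t x v X V \<longrightarrow>
            (let K = C\<^sub>0 (C21_norm (closure (Omega \<xi>)) \<xi>)
                         (C01_norm ({0..T} \<times> closure (Omega \<xi>)) (\<lambda>(t, x). E t x));
                 B = (norm v + 1) * \<bar>s - t\<bar> +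
                     sup_norm ({0..T} \<times> closure (Omega \<xi>)) (\<lambda>(t, x). E t x) * (s - t)\<^sup>2
             in (X s \<in> collar \<xi> \<delta> \<longrightarrow>
                   exp (- (K * B)) * alpha \<xi> E t x v \<le> alpha \<xi> E s (X s) (V s)) \<and>
                alpha \<xi> E s (X s) (V s) \<le> exp (K * B) * alpha \<xi> E t x v)))"
\<comment> \<open>For fixed \<open>C\<^sub>\<Omega>\<close> and \<open>c\<^sub>0\<close> the rate is
  a function of the two norms, so it is chosen before \<xi>, \<open>T\<close> and
  \<open>E\<close>.\<close>
proof (intro exI[of _ "growth_rate C\<^sub>\<Omega> c\<^sub>0"] allI impI)
  fix \<xi> :: "'a \<Rightarrow> real" and T :: real and E :: "real \<Rightarrow> 'a \<Rightarrow> 'a"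
  assume "uniformly_convex_domain C\<^sub>\<Omega> \<xi>" "T > 0"
    "\<exists>L. L-lipschitz_on ({0..T} \<times> closure (Omega \<xi>)) (\<lambda>(t, x). E t x)"
    "\<forall>t\<in>{0..T}. \<forall>x\<in>frontier (Omega \<xi>). E t x \<bullet> grad \<xi> x \<ge> c\<^sub>0"
  with assms interpret outward_field C\<^sub>\<Omega> c\<^sub>0 \<xi> T E by unfold_locales
  obtain \<delta> where "\<delta> > 0" and shallow: "\<And>x. x \<in> collar \<xi> \<delta> \<Longrightarrow> x \<in> D \<and> \<bar>\<xi> x\<bar> \<le> \<eta>"
    using collar_shallow by blast
  have "(X s \<in> collar \<xi> \<delta> \<longrightarrow> exp (- (K * B)) * alpha \<xi> E t x v \<le> alpha \<xi> E s (X s) (V s)) \<and>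
      alpha \<xi> E s (X s) (V s) \<le> exp (K * B) * alpha \<xi> E t x v"
    if t: "t \<in> {0..T}" and x: "x \<in> collar \<xi> \<delta>" and s: "s \<in> {0..T}"
      and ch: "characteristic \<xi> T E t x v X V"
      and B: "B = (norm v + 1) * \<bar>s - t\<bar> + S\<^sub>E * (s - t)\<^sup>2" for t x v s X V B
  proof (intro conjI impI)
    have start: "X t = x" "V t = v" using ch by (auto simp: characteristic_def)
    have eq: "alpha_hat t x v = alpha \<xi> E t x v"
      using shallow[OF x] by (simp add: alpha_hat_eq_alpha)
    \<comment> \<open>\<open>alpha\<close> never exceeds \<open>alpha_hat\<close> and equals it at
      the start, so this holds wherever the trajectory is at time \<open>s\<close>.\<close>
    show "alpha \<xi> E s (X s) (V s) \<le> exp (K * B) * alpha \<xi> E t x v"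
      using alpha_hat_growth[OF ch t s t, of s] alpha_le_alpha_hat[of s "X s" "V s"]
      by (simp add: start eq B)
    \<comment> \<open>The reverse comparison uses equality at time \<open>s\<close>, available in
      the collar; deep inside, \<open>alpha\<close> may be negative.\<close>
    assume "X s \<in> collar \<xi> \<delta>"
    then have "alpha_hat s (X s) (V s) = alpha \<xi> E s (X s) (V s)"
      using shallow by (simp add: alpha_hat_eq_alpha)
    then have "alpha \<xi> E t x v \<le> exp (K * B) * alpha \<xi> E s (X s) (V s)"
      using alpha_hat_growth[OF ch t t s, of s] by (simp add: start eq B abs_minus_commute)
    then show "exp (- (K * B)) * alpha \<xi> E t x v \<le> alpha \<xi> E s (X s) (V s)"
      by (simp add: exp_minus field_simps)
  qed
  with \<open>\<delta> > 0\<close> kinetic_distance_alpha[OF shallow]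
  show "\<exists>\<delta>>0. kinetic_distance \<xi> T \<delta> (alpha \<xi> E) \<and>
      (\<forall>t\<in>{0..T}. \<forall>x\<in>collar \<xi> \<delta>. \<forall>v. \<forall>s\<in>{0..T}. \<forall>X V.
        characteristic \<xi> T E t x v X V \<longrightarrow>
        (let K = growth_rate C\<^sub>\<Omega> c\<^sub>0 (C21_norm (closure (Omega \<xi>)) \<xi>)
                     (C01_norm ({0..T} \<times> closure (Omega \<xi>)) (\<lambda>(t, x). E t x));
             B = (norm v + 1) * \<bar>s - t\<bar> +
                 sup_norm ({0..T} \<times> closure (Omega \<xi>)) (\<lambda>(t, x). E t x) * (s - t)\<^sup>2
         in (X s \<in> collar \<xi> \<delta> \<longrightarrow>
               exp (- (K * B)) * alpha \<xi> E t x v \<le> alpha \<xi> E s (X s) (V s)) \<and>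
            alpha \<xi> E s (X s) (V s) \<le> exp (K * B) * alpha \<xi> E t x v))"
    unfolding Let_def N_def M_def by blast
qed

end
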